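(* Let $t\ge 1$, let $\mathrm G$ be a finite simple graph on $n$ vertices, and let $\mathcal G=(\mathrm G_0,\dots,\mathrm G_{t-1})$ be a commutative $t$-decomposition of $\mathrm G$ with $|E(\mathrm G_i)|=m_i$ and with a compatible numbering $\theta_i^{j}$ ($0\le i<t$, $1\le j\le n$) of its eigenvalues. Let $\mathcal H=(\mathrm H_0,\dots,\mathrm H_{t-1})$, $\mathrm H_i=(\mathrm B,\mathrm C_i)$, be an ordered list of coherent bsymmetric cylinders with common base $\mathrm B$. Then, as an identity of rational functions of $x$, $$\phi(\mathcal G\boxtimes\mathcal H,x)=\left(\prod_{i=0}^{t-1}\phi(C_i,x)^{m_i}\right)\det\left(I_n\otimes(xI-B)-\sum_{i=0}^{t-1}\Big(G_i\otimes\big(E_i^{bb'}+R_a(C_i)\big)+D_i\otimes R_d(C_i)\Big)\right),$$ where $D_i$ is the diagonal matrix of vertex degrees of $\mathrm G_i$. In particular: (a) If each $\mathrm G_i$ is a $d_i$-regular graph, then $$\phi(\mathcal G\boxtimes\mathcal H,x)=\left(\prod_{i=0}^{t-1}\phi(C_i,x)^{m_i}\right)\prod_{j=1}^n\phi\left(B+\sum_{i=0}^{t-1}\Big(d_iR_d(C_i)+\theta_i^{j}\big(E_i^{bb'}+R_a(C_i)\big)\Big),\,x\right).$$ (b) If each $\mathrm H_i$ has no inner-vertex, then $$\phi(\mathcal G\boxtimes\mathcal H,x)=\prod_{j=1}^n\phi\left(B+\sum_{i=0}^{t-1}\theta_i^{j}E_i^{bb'},\,x\right).$$ Specifically, if moreover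 the base $\mathrm B$ is an empty graph (a graph with no edges), then $$\phi(\mathcal G\boxtimes\mathcal H,x)=\prod_{j=1}^n\phi\left(\sum_{i=0}^{t-1}\theta_i^{j}E_i^{bb'},\,x\right).$$
   Context: All graphs are finite and simple. A graph is written in roman type ($\mathrm G$) and its adjacency matrix in italic type ($G$). $M^*$ is the transpose of $M$, $\otimes$ is the Kronecker product, and $\phi(M,x)=\det(xI-M)$; for a graph, $\phi$ is that of its adjacency matrix. The same notation $\phi(M,x)=\det(xI-M)$ is used when the entries of $M$ are themselves rational functions of the same variable $x$. **Bsymmetric cylinder.** A bsymmetric cylinder $\mathrm H=(\mathrm B,\mathrm C)$ is a finite simple graph $\mathrm H$ with two vertex-disjoint, isomorphic, vertex-labeled induced subgraphs (the bases) $\mathrm B$ on $\{b_0,\dots,b_\ell\}$ and $\mathrm B'$ on $\{b'_0,\dots,b'_\ell\}$, $\ell\ge 0$, together with an automorphism $\sigma$ of $\mathrm H$ with $\sigma(\mathrm B)=\mathrm B'$, $\sigma(\mathrm B')=\mathrm B$, $\sigma(b_i)=b'_i$, $\sigma(b'_i)=b_i$ for all $i$. The vertices outside the two bases are the inner-vertices (there may be none), and $\mathrm C$ is the subgraph induced on them. Ordering vertices as $b_0,\dots,b_\ell,b'_0,\dots,b'_\ell$, inner-vertices, the adjacency matrix is $$H=\begin{bmatrix} B & E^{bb'} & E^{bc} \\ (E^{bb'})^* & B & E^{b'c} \\ (E^{bc})^* & (E^{b'c})^* & C \end{bmatrix}.$$ For a bsymmetric cylinder one has (for $x$ not an eigenvalue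 of $C$) $$\begin{bmatrix} E^{bc} \\ E^{b'c} \end{bmatrix}(xI-C)^{-1}\begin{bmatrix} (E^{bc})^* & (E^{b'c})^* \end{bmatrix}=\begin{bmatrix} R_d(C) & R_a(C) \\ R_a(C) & R_d(C) \end{bmatrix},$$ i.e. $R_d(C)=E^{bc}(xI-C)^{-1}(E^{bc})^*=E^{b'c}(xI-C)^{-1}(E^{b'c})^*$ and $R_a(C)=E^{bc}(xI-C)^{-1}(E^{b'c})^*=E^{b'c}(xI-C)^{-1}(E^{bc})^*$; these define matrices $R_d(C),R_a(C)$ whose entries are rational functions of $x$. If there are no inner-vertices, $R_d(C)=R_a(C)=0$ and $\phi(C,x)=1$. For the cylinder $\mathrm H_i$ the blocks are written $E_i^{bb'},E_i^{bc},E_i^{b'c},C_i$. **Coherent.** A list $(\mathrm H_0,\dots,\mathrm H_{t-1})$ of cylinders is coherent if all have the same (isomorphic, as labeled graphs) base $\mathrm B$: $\mathrm H_i=(\mathrm B,\mathrm C_i)$, all with the same matrix $B$. **Commutative $t$-decomposition.** This is a family $(\mathrm G_0,\dots,\mathrm G_{t-1})$ of $t$ edge-disjoint spanning subgraphs of $\mathrm G$, each with no isolated vertex, such that $G_iG_j=G_jG_i$ for all distinct $i,j$ and $G=\sum_{i=0}^{t-1}G_i$. A numbering $\theta_i^{j}$, $1\le j\le n$, of the spectrum of each $G_i$ is compatible if there is a single unitary matrix $U$ such that for every $i$ the matrix $UG_iU^{-1}$ is diagonal with $(j,j)$ entry $\theta_i^{j}$. **Cylindrical construct.** $\mathcal G\boxtimes\mathcal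 H$ is the graph obtained by replacing each edge $uv$ of $\mathrm G_i$ by a copy of the cylinder $\mathrm H_i$ (one base at $u$, the other at $v$; by the symmetry $\sigma$ the choice does not matter up to isomorphism), for all $0\le i<t$, and then identifying, label by label, all the bases located at the same vertex of $\mathrm G$. Its adjacency matrix is $$\begin{bmatrix} I_n\otimes B+\sum_{i}G_i\otimes E_i^{bb'} & M_0 & \cdots & M_{t-1} \\ M_0^* & I_{m_0}\otimes C_0 & & 0 \\ \vdots & & \ddots & \\ M_{t-1}^* & 0 & & I_{m_{t-1}}\otimes C_{t-1} \end{bmatrix},$$ where $M_i$ is an $n\times m_i$ block matrix whose block column corresponding to an edge $uv$ of $\mathrm G_i$ has exactly two nonzero blocks, $E_i^{bc}$ in block row $u$ and $E_i^{b'c}$ in block row $v$. *)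

theory Defs
  imports
    "Graph_Theory.Graph_Theory"
    "Jordan_Normal_Form.Char_Poly"
    "Jordan_Normal_Form.Gauss_Jordan_Elimination"
    "Jordan_Normal_Form.Schur_Decomposition"
begin

text \<open>
  A finite simple graph is a \<open>pair_graph\<close>: a finite, loop-free digraph with a symmetric arc
  set, so that every undirected edge contributes two opposite arcs.  Matrices of a graph are taken
  with respect to explicit lists of vertices.
\<close>

definition adjacency_block :: "'a pair_pre_digraph \<Rightarrow> 'a list \<Rightarrow> 'a list \<Rightarrow> complex mat" where
  "adjacency_block G us ws =
     mat (length us) (length ws) (\<lambda>(p, q). if (us ! p, ws ! q) \<in> parcs G then 1 else 0)"

definition adjacency_matrix :: "'a pair_pre_digraph \<Rightarrow> 'a list \<Rightarrow> complex mat" where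
  "adjacency_matrix G vs = adjacency_block G vs vs"

definition degree_matrix :: "'a pair_pre_digraph \<Rightarrow> 'a list \<Rightarrow> complex mat" where
  "degree_matrix G vs = mat (length vs) (length vs)
     (\<lambda>(p, q). if p = q then of_nat (out_degree (with_proj G) (vs ! p)) else 0)"

definition edge_count :: "'a pair_pre_digraph \<Rightarrow> nat" where
  "edge_count G = card {{u, v} | u v. (u, v) \<in> parcs G}"

definition regular_graph :: "nat \<Rightarrow> 'a pair_pre_digraph \<Rightarrow> bool" where
  "regular_graph d G \<longleftrightarrow> (\<forall>v \<in> pverts G. out_degree (with_proj G) v = d)"

definition kronecker :: "'a::times mat \<Rightarrow> 'a mat \<Rightarrow> 'a mat" where
  "kronecker A B = mat (dim_row A * dim_row B) (dim_col A * dim_col B)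
     (\<lambda>(p, q). A $$ (p div dim_row B, q div dim_col B) * B $$ (p mod dim_row B, q mod dim_col B))"

definition sum_mats :: "nat \<Rightarrow> nat \<Rightarrow> ('i \<Rightarrow> 'a::comm_monoid_add mat) \<Rightarrow> 'i set \<Rightarrow> 'a mat" where
  "sum_mats nr nc M I = mat nr nc (\<lambda>(p, q). \<Sum>i\<in>I. M i $$ (p, q))"

text \<open>Only meaningful for invertible matrices.\<close>

definition minverse :: "'a::field mat \<Rightarrow> 'a mat" where
  "minverse A = the (mat_inverse A)"

text \<open>
  Rational functions of one variable are elements of the fraction field of the polynomials.
  For a matrix \<open>M\<close> of rational functions of \<open>x\<close>, \<open>rat_phi\<close> is \<open>det (x I - M)\<close>,
  with the same \<open>x\<close> as in the entries of \<open>M\<close>.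
\<close>

type_synonym ratfun = "complex poly fract"

definition ratvar :: ratfun where
  "ratvar = to_fract [:0, 1:]"

definition ratconst :: "complex \<Rightarrow> ratfun" where
  "ratconst c = to_fract [:c:]"

definition lift_mat :: "complex mat \<Rightarrow> ratfun mat" where
  "lift_mat M = map_mat ratconst M"

definition rat_phi :: "ratfun mat \<Rightarrow> ratfun" where
  "rat_phi M = det (ratvar \<cdot>\<^sub>m 1\<^sub>m (dim_row M) - M)"

lemma rat_phi_lift_mat:
  assumes "M \<in> carrier_mat n n"
  shows "rat_phi (lift_mat M) = to_fract (char_poly M)"
proof -
  interpret h: comm_ring_hom "to_fract :: complex poly \<Rightarrow> ratfun"
    by unfold_locales auto
  have "ratvar \<cdot>\<^sub>m 1\<^sub>m n - lift_mat M = map_mat to_fract (char_poly_matrix M)"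
    using assms
    by (intro eq_matI) (auto simp: lift_mat_def char_poly_matrix_def ratvar_def ratconst_def
        simp flip: to_fract_diff to_fract_uminus)
  then show ?thesis
    using assms by (simp add: rat_phi_def char_poly_def h.hom_det lift_mat_def)
qed


text \<open>
  The lists \<open>base_verts\<close> and \<open>base_verts'\<close> are the labelled vertices
  \<open>b_0, \<dots>, b_l\<close> and \<open>b'_0, \<dots>, b'_l\<close>.  The order of the list
  \<open>inner_verts\<close> only fixes the order of the rows and columns of the matrices below.
\<close>

record 'h cylinder =
  cgraph :: "'h pair_pre_digraph"
  base_verts :: "'h list"
  base_verts' :: "'h list"
  inner_verts :: "'h list"

definition graph_automorphism :: "'h pair_pre_digraph \<Rightarrow> ('h \<Rightarrow> 'h) \<Rightarrow> bool" where
  "graph_automorphism H \<sigma> \<longleftrightarrow> bij_betw \<sigma> (pverts H) (pverts H) \<and>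
     (\<forall>x \<in> pverts H. \<forall>y \<in> pverts H. (\<sigma> x, \<sigma> y) \<in> parcs H \<longleftrightarrow> (x, y) \<in> parcs H)"

text \<open>The bijection \<open>p \<mapsto> bs ! p\<close> is an isomorphism from \<open>B\<close> onto the subgraph of \<open>H\<close> induced on \<open>bs\<close>.\<close>

definition labelled_copy :: "nat pair_pre_digraph \<Rightarrow> 'h pair_pre_digraph \<Rightarrow> 'h list \<Rightarrow> bool" where
  "labelled_copy B H bs \<longleftrightarrow> pverts B = {..<length bs} \<and> distinct bs \<and> set bs \<subseteq> pverts H \<and>
     (\<forall>p < length bs. \<forall>q < length bs. (bs ! p, bs ! q) \<in> parcs H \<longleftrightarrow> (p, q) \<in> parcs B)"

definition bsymmetric_cylinder :: "nat pair_pre_digraph \<Rightarrow> 'h cylinder \<Rightarrow> bool" where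
  "bsymmetric_cylinder B H \<longleftrightarrow>
     pair_graph B \<and> pair_graph (cgraph H) \<and>
     base_verts H \<noteq> [] \<and>
     distinct (base_verts H @ base_verts' H @ inner_verts H) \<and>
     set (base_verts H @ base_verts' H @ inner_verts H) = pverts (cgraph H) \<and>
     labelled_copy B (cgraph H) (base_verts H) \<and>
     labelled_copy B (cgraph H) (base_verts' H) \<and>
     (\<exists>\<sigma>. graph_automorphism (cgraph H) \<sigma> \<and>
          map \<sigma> (base_verts H) = base_verts' H \<and> map \<sigma> (base_verts' H) = base_verts H)"

definition coherent :: "nat pair_pre_digraph \<Rightarrow> nat \<Rightarrow> (nat \<Rightarrow> 'h cylinder) \<Rightarrow> bool" where
  "coherent B t Hs \<longleftrightarrow> (\<forall>i<t. bsymmetric_cylinder B (Hs i))"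

definition base_matrix :: "nat pair_pre_digraph \<Rightarrow> complex mat" where
  "base_matrix B = adjacency_matrix B [0..<card (pverts B)]"

definition Ebb' :: "'h cylinder \<Rightarrow> complex mat" where
  "Ebb' H = adjacency_block (cgraph H) (base_verts H) (base_verts' H)"

definition Ebc :: "'h cylinder \<Rightarrow> complex mat" where
  "Ebc H = adjacency_block (cgraph H) (base_verts H) (inner_verts H)"

definition Eb'c :: "'h cylinder \<Rightarrow> complex mat" where
  "Eb'c H = adjacency_block (cgraph H) (base_verts' H) (inner_verts H)"

definition Cmat :: "'h cylinder \<Rightarrow> complex mat" where
  "Cmat H = adjacency_matrix (cgraph H) (inner_verts H)"

definition resolvent :: "complex mat \<Rightarrow> ratfun mat" where
  "resolvent C = minverse (ratvar \<cdot>\<^sub>m 1\<^sub>m (dim_row C) - lift_mat C)"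

text \<open>
  The automorphism of the cylinder makes it irrelevant which base is put first here.
  Without inner vertices the products below run over an empty index, giving zero matrices.
\<close>

definition Rd :: "'h cylinder \<Rightarrow> ratfun mat" where
  "Rd H = lift_mat (Ebc H) * resolvent (Cmat H) * transpose_mat (lift_mat (Ebc H))"

definition Ra :: "'h cylinder \<Rightarrow> ratfun mat" where
  "Ra H = lift_mat (Ebc H) * resolvent (Cmat H) * transpose_mat (lift_mat (Eb'c H))"


definition commutative_decomposition ::
  "'v list \<Rightarrow> nat \<Rightarrow> 'v pair_pre_digraph \<Rightarrow> (nat \<Rightarrow> 'v pair_pre_digraph) \<Rightarrow> bool" where
  "commutative_decomposition vs t G Gs \<longleftrightarrow>
     (\<forall>i<t. pair_graph (Gs i) \<and> spanning (with_proj (Gs i)) (with_proj G) \<and>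
            (\<forall>v \<in> pverts (Gs i). \<exists>w. (v, w) \<in> parcs (Gs i))) \<and>
     (\<forall>i<t. \<forall>j<t. i \<noteq> j \<longrightarrow> parcs (Gs i) \<inter> parcs (Gs j) = {} \<and>
            adjacency_matrix (Gs i) vs * adjacency_matrix (Gs j) vs =
            adjacency_matrix (Gs j) vs * adjacency_matrix (Gs i) vs) \<and>
     adjacency_matrix G vs =
       sum_mats (length vs) (length vs) (\<lambda>i. adjacency_matrix (Gs i) vs) {..<t}"

text \<open>
  The eigenvalues are numbered \<open>\<theta> i j\<close> with \<open>j = 0, \<dots>, n - 1\<close>.  That \<open>\<theta> i\<close> lists the spectrum
  of the \<open>i\<close>-th matrix with multiplicities follows from the simultaneous diagonalisation.
\<close>

definition compatible_numbering ::
  "'v list \<Rightarrow> nat \<Rightarrow> (nat \<Rightarrow> 'v pair_pre_digraph) \<Rightarrow> (nat \<Rightarrow> nat \<Rightarrow> complex) \<Rightarrow> bool" where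
  "compatible_numbering vs t Gs \<theta> \<longleftrightarrow>
     (\<exists>U \<in> carrier_mat (length vs) (length vs).
        U * mat_adjoint U = 1\<^sub>m (length vs) \<and>
        (\<forall>i<t. diagonal_mat (U * adjacency_matrix (Gs i) vs * minverse U) \<and>
           (\<forall>j<length vs. (U * adjacency_matrix (Gs i) vs * minverse U) $$ (j, j) = \<theta> i j)))"


text \<open>
  An orientation selects, for every edge, the end at which the base \<open>base_verts\<close> (rather than
  \<open>base_verts'\<close>) is placed when the edge is replaced by a cylinder.
\<close>

definition orientation :: "'v pair_pre_digraph \<Rightarrow> ('v \<times> 'v) set \<Rightarrow> bool" where
  "orientation G A \<longleftrightarrow> A \<subseteq> parcs G \<and> (\<forall>u v. (u, v) \<in> parcs G \<longrightarrow> ((u, v) \<in> A) \<noteq> ((v, u) \<in> A))"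

text \<open>
  \<open>BaseVert v p\<close> is the vertex that results from identifying all base vertices labelled \<open>p\<close>
  located at \<open>v\<close>; \<open>InnerVert i e c\<close> is the copy of the inner vertex \<open>c\<close> in the
  \<open>i\<close>-th cylinder replacing the oriented edge \<open>e\<close>.
\<close>

datatype ('v, 'h) construct_vertex = BaseVert 'v nat | InnerVert nat "'v \<times> 'v" 'h

definition label_of :: "'h list \<Rightarrow> 'h \<Rightarrow> nat" where
  "label_of bs x = (THE p. p < length bs \<and> bs ! p = x)"

definition place ::
  "'h cylinder \<Rightarrow> nat \<Rightarrow> 'v \<times> 'v \<Rightarrow> 'h \<Rightarrow> ('v, 'h) construct_vertex" where
  "place H i e x =
     (if x \<in> set (base_verts H) then BaseVert (fst e) (label_of (base_verts H) x)
      else if x \<in> set (base_verts' H) then BaseVert (snd e) (label_of (base_verts' H) x)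
      else InnerVert i e x)"

text \<open>The argument \<open>ors\<close> consists of orientations of the graphs of the decomposition.\<close>

definition cylindrical_construct ::
  "nat \<Rightarrow> (nat \<Rightarrow> ('v \<times> 'v) set) \<Rightarrow> (nat \<Rightarrow> 'h cylinder) \<Rightarrow>
     ('v, 'h) construct_vertex pair_pre_digraph" where
  "cylindrical_construct t ors Hs =
     \<lparr> pverts = (\<Union>i<t. \<Union>e\<in>ors i. place (Hs i) i e ` pverts (cgraph (Hs i))),
       parcs = (\<Union>i<t. \<Union>e\<in>ors i.
          map_prod (place (Hs i) i e) (place (Hs i) i e) ` parcs (cgraph (Hs i))) \<rparr>"

lemma label_of_nth: "distinct bs \<Longrightarrow> p < length bs \<Longrightarrow> label_of bs (bs ! p) = p"
  unfolding label_of_def by (rule the_equality) (auto simp: nth_eq_iff_index_eq)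

lemma inj_on_label_of: "distinct bs \<Longrightarrow> inj_on (label_of bs) (set bs)"
  by (auto simp: inj_on_def in_set_conv_nth label_of_nth)

lemma inj_place:
  assumes "bsymmetric_cylinder B H" "fst e \<noteq> snd e"
  shows "inj (place H i e)"
proof -
  have "distinct (base_verts H)" "distinct (base_verts' H)"
    using assms(1) by (auto simp: bsymmetric_cylinder_def)
  then have "inj_on (label_of (base_verts H)) (set (base_verts H))"
    "inj_on (label_of (base_verts' H)) (set (base_verts' H))"
    by (auto intro: inj_on_label_of)
  then show ?thesis
    using assms(2) by (auto simp: inj_def place_def inj_on_def)
qed

lemma pair_graph_cylindrical_construct:
  assumes Gs: "\<And>i. i < t \<Longrightarrow> pair_graph (Gs i)"
    and ors: "\<And>i. i < t \<Longrightarrow> orientation (Gs i) (ors i)"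
    and Hs: "coherent B t Hs"
  shows "pair_graph (cylindrical_construct t ors Hs)"
proof -
  let ?K = "cylindrical_construct t ors Hs"
  have H: "pair_graph (cgraph (Hs i))" if "i < t" for i
    using Hs that by (auto simp: coherent_def bsymmetric_cylinder_def)
  have fin: "finite (ors i)" if "i < t" for i
    using ors[OF that] Gs[OF that] finite_subset
    by (auto simp: orientation_def pair_graph_def pair_digraph_def pair_fin_digraph_def
        pair_fin_digraph_axioms_def)
  have finH: "finite (pverts (cgraph (Hs i)))" "finite (parcs (cgraph (Hs i)))" if "i < t" for i
    using H[OF that] by (auto simp: pair_graph_def pair_digraph_def pair_fin_digraph_def
        pair_fin_digraph_axioms_def)
  have wfH: "x \<in> pverts (cgraph (Hs i)) \<and> y \<in> pverts (cgraph (Hs i)) \<and> x \<noteq> y \<and>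
      (y, x) \<in> parcs (cgraph (Hs i))" if "i < t" "(x, y) \<in> parcs (cgraph (Hs i))" for i x y
  proof -
    interpret pair_graph "cgraph (Hs i)" by (rule H[OF that(1)])
    show ?thesis
      using that(2) arc_fst_in_verts arc_snd_in_verts pair_no_loops pair_sym_arcs
      by (fastforce simp: symmetric_def sym_def)
  qed
  have inj: "inj (place (Hs i) i e)" if "i < t" "e \<in> ors i" for i e
  proof (rule inj_place)
    show "bsymmetric_cylinder B (Hs i)" using Hs that by (simp add: coherent_def)
    interpret pair_graph "Gs i" by (rule Gs[OF that(1)])
    show "fst e \<noteq> snd e"
      using ors[OF that(1)] that(2) pair_no_loops by (auto simp: orientation_def)
  qed
  show ?thesis
  proof unfold_locales
    show "finite (pverts ?K)" "finite (parcs ?K)"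
      using fin finH by (auto simp: cylindrical_construct_def)
    show wf: "fst a \<in> pverts ?K" "snd a \<in> pverts ?K" if "a \<in> parcs ?K" for a
      using that wfH by (fastforce simp: cylindrical_construct_def)+
    show "fst a \<noteq> snd a" if "a \<in> parcs ?K" for a
      using that wfH inj by (fastforce simp: cylindrical_construct_def dest: injD)
    have "sym (parcs ?K)"
      using wfH by (fastforce simp: cylindrical_construct_def sym_def)
    then show "symmetric (with_proj ?K)"
      by (simp add: symmetric_def)
  qed
qed

end

theory Submission
  imports Defs
begin

text \<open>
  The rows and columns of the matrix of the construct that belong to one cylinder copy form a
  block \<open>xI - C\<^sub>i\<close>, and blocks of different copies do not interact.  Eliminating the
  blocks one after the other by Schur complements produces the factors \<open>\<phi>(C\<^sub>i, x)\<close>, and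
  a copy over the edge \<open>uv\<close> changes the remaining matrix by \<open>R\<^sub>d\<close> at \<open>(u, u)\<close> and
  \<open>(v, v)\<close> and by \<open>R\<^sub>a\<close> at \<open>(u, v)\<close> and \<open>(v, u)\<close>; here the automorphism \<open>\<sigma>\<close>
  enters, because the inverse of \<open>xI - C\<^sub>i\<close> is invariant under it.  For (a) and (b) the
  degree terms are scalar, and conjugating by \<open>U \<otimes> I\<close> makes the remaining matrix block
  diagonal.
\<close>

section \<open>Matrices indexed by lists\<close>

text \<open>Two obstacles shape the development. The vertex order \<open>ws\<close> is arbitrary and
  the construct merges vertices, so computing with positions would be unwieldy. Matrices are
  therefore written \<open>fmat f xs ys\<close>, a kernel \<open>f\<close> on labels read along
  lists: reordering is a change of list, a product is a sum over a set, and a Schur complement is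
  again a kernel, so that elimination can be iterated. Moreover, the inverse of xI - C has rational
  entries. Determinants therefore live in the fraction field of the polynomials, where xI - C is
  always invertible because its determinant is a monic polynomial; (b) returns to polynomials by
  injectivity of the embedding. Two combinatorial hypotheses have a precise place: edge-disjointness
  makes the 0/1 adjacency between base vertices equal to a sum of blocks, and the absence of
  isolated vertices together with t \<ge> 1 puts a base at every vertex of G. Parts (a) and (b) are
  instances of one diagonalisation, whose degree condition concerns the products of degrees with
  entries of R_d: in (a) the degrees are constant, in (b) R_d vanishes.\<close>

definition fmat :: "('a \<Rightarrow> 'b \<Rightarrow> 'c) \<Rightarrow> 'a list \<Rightarrow> 'b list \<Rightarrow> 'c mat" where
  "fmat f xs ys = mat (length xs) (length ys) (\<lambda>(p, q). f (xs ! p) (ys ! q))"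

lemma dim_fmat [simp]:
  "dim_row (fmat f xs ys) = length xs" "dim_col (fmat f xs ys) = length ys"
  "fmat f xs ys \<in> carrier_mat (length xs) (length ys)"
  by (auto simp: fmat_def)

lemma index_fmat [simp]:
  "p < length xs \<Longrightarrow> q < length ys \<Longrightarrow> fmat f xs ys $$ (p, q) = f (xs ! p) (ys ! q)"
  by (simp add: fmat_def)

lemma fmat_cong:
  "(\<And>x y. x \<in> set xs \<Longrightarrow> y \<in> set ys \<Longrightarrow> f x y = g x y) \<Longrightarrow> fmat f xs ys = fmat g xs ys"
  by (intro eq_matI) auto

lemma fmat_eqD:
  assumes "fmat f xs ys = fmat g xs ys" "x \<in> set xs" "y \<in> set ys"
  shows "f x y = g x y"
proof -
  obtain p q where "p < length xs" "xs ! p = x" "q < length ys" "ys ! q = y"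
    using assms(2,3) by (auto simp: in_set_conv_nth)
  then show ?thesis
    using arg_cong[OF assms(1), of "\<lambda>M. M $$ (p, q)"] by auto
qed

lemma fmat_map: "fmat f (map g xs) (map h ys) = fmat (\<lambda>x y. f (g x) (h y)) xs ys"
  by (intro eq_matI) auto

lemma fmat_one:
  "distinct xs \<Longrightarrow> fmat (\<lambda>x y. if x = y then 1 else 0) xs xs = 1\<^sub>m (length xs)"
  by (intro eq_matI) (auto simp: nth_eq_iff_index_eq)

lemma fmat_mult:
  fixes f :: "'a \<Rightarrow> 'b \<Rightarrow> 'd::semiring_0"
  assumes "distinct ys"
  shows "fmat f xs ys * fmat g ys zs = fmat (\<lambda>x z. \<Sum>y\<in>set ys. f x y * g y z) xs zs"
proof (rule eq_matI)
  fix p q assume "p < dim_row (fmat (\<lambda>x z. \<Sum>y\<in>set ys. f x y * g y z) xs zs)"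
    "q < dim_col (fmat (\<lambda>x z. \<Sum>y\<in>set ys. f x y * g y z) xs zs)"
  then have pq: "p < length xs" "q < length zs" by auto
  have "(\<Sum>y\<in>set ys. f (xs ! p) y * g y (zs ! q)) =
      (\<Sum>k<length ys. f (xs ! p) (ys ! k) * g (ys ! k) (zs ! q))"
    by (rule sum.reindex_bij_betw[OF bij_betw_nth[OF assms refl refl], symmetric])
  then show "(fmat f xs ys * fmat g ys zs) $$ (p, q) =
      fmat (\<lambda>x z. \<Sum>y\<in>set ys. f x y * g y z) xs zs $$ (p, q)"
    using pq by (simp add: scalar_prod_def atLeast0LessThan)
qed auto

lemma transpose_fmat: "transpose_mat (fmat f xs ys) = fmat (\<lambda>y x. f x y) ys xs"
  by (intro eq_matI) auto

section \<open>Determinants under similarity, reordering and block elimination\<close>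

lemma det_similar:
  fixes P Q M :: "'a::idom mat"
  assumes "P \<in> carrier_mat n n" "Q \<in> carrier_mat n n" "M \<in> carrier_mat n n" "P * Q = 1\<^sub>m n"
  shows "det (P * M * Q) = det M"
proof -
  have "det P * det Q = 1"
    using assms by (metis det_mult det_one)
  moreover have "det (P * M * Q) = det P * det M * det Q"
    using assms by (metis det_mult mult_carrier_mat)
  ultimately show ?thesis
    by (metis mult.assoc mult.commute mult.right_neutral)
qed

text \<open>The Kronecker delta read along two different orderings of one set is a permutation
  matrix; conjugating by it passes from one ordering to the other.\<close>

lemma det_fmat_reorder:
  fixes f :: "'a \<Rightarrow> 'a \<Rightarrow> 'b::idom"
  assumes d: "distinct xs" "distinct ys" and s: "set xs = set ys"
  shows "det (fmat f xs xs) = det (fmat f ys ys)"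
proof -
  let ?I = "\<lambda>x y. if x = y then 1 else (0::'b)"
  have len: "length ys = length xs"
    using d s by (metis distinct_card)
  have c: "fmat h xs ys \<in> carrier_mat (length xs) (length xs)"
    "fmat h ys xs \<in> carrier_mat (length xs) (length xs)"
    "fmat h ys ys \<in> carrier_mat (length xs) (length xs)" for h :: "'a \<Rightarrow> 'a \<Rightarrow> 'b"
    using len dim_fmat(3) by metis+
  have "fmat ?I xs ys * fmat f ys ys * fmat ?I ys xs = fmat f xs xs"
    using d s by (auto simp: fmat_mult if_distrib[of "\<lambda>x. x * _"] if_distrib[of "\<lambda>x. _ * x"]
        intro!: fmat_cong cong: if_cong)
  moreover have "fmat ?I xs ys * fmat ?I ys xs = 1\<^sub>m (length xs)"
    using d s by (subst fmat_one[OF d(1), symmetric])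
      (auto simp: fmat_mult if_distrib[of "\<lambda>x. x * _"] intro!: fmat_cong cong: if_cong)
  ultimately show ?thesis
    using det_similar[OF c(1) c(2) c(3)] by metis
qed

lemma fmat_append:
  "fmat f (us @ bs) (us' @ bs') =
    four_block_mat (fmat f us us') (fmat f us bs') (fmat f bs us') (fmat f bs bs')"
  by (intro eq_matI) (auto simp: nth_append)

text \<open>A column operation clears \<open>C\<close>: multiply on the right by the unit lower
  triangular block matrix with lower left block \<open>- (W * C)\<close>. Passing the inverse
  \<open>W\<close> of \<open>D\<close> explicitly allows any integral domain.\<close>

lemma det_schur_complement:
  fixes A B C D W :: "'a::idom mat"
  assumes A: "A \<in> carrier_mat n n" and B: "B \<in> carrier_mat n m"
    and C: "C \<in> carrier_mat m n" and D: "D \<in> carrier_mat m m"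
    and W: "W \<in> carrier_mat m m" and DW: "D * W = 1\<^sub>m m"
  shows "det (four_block_mat A B C D) = det D * det (A - B * W * C)"
proof -
  have "four_block_mat A B C D * four_block_mat (1\<^sub>m n) (0\<^sub>m n m) (- (W * C)) (1\<^sub>m m) =
      four_block_mat (A * 1\<^sub>m n + B * (- (W * C))) (A * 0\<^sub>m n m + B * 1\<^sub>m m)
        (C * 1\<^sub>m n + D * (- (W * C))) (C * 0\<^sub>m n m + D * 1\<^sub>m m)"
    using assms by (intro mult_four_block_mat) auto
  also have "A * 1\<^sub>m n + B * (- (W * C)) = A - B * W * C"
    using assms by (intro eq_matI) (auto simp: assoc_mult_mat)
  also have "C * 1\<^sub>m n + D * (- (W * C)) = 0\<^sub>m m n"
  proof -
    have "D * (W * C) = C"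
      using assms by (simp flip: assoc_mult_mat[OF D W C])
    then show ?thesis using assms by auto
  qed
  finally have "det (four_block_mat A B C D) *
        det (four_block_mat (1\<^sub>m n) (0\<^sub>m n m) (- (W * C)) (1\<^sub>m m)) =
      det (four_block_mat (A - B * W * C) B (0\<^sub>m m n) D)"
    using assms by (subst det_mult[of _ "n + m", symmetric]) auto
  moreover have "det (four_block_mat (1\<^sub>m n) (0\<^sub>m n m) (- (W * C)) (1\<^sub>m m)) = 1"
    using assms by (subst det_four_block_mat_upper_right_zero[where n = n and m = m]) auto
  moreover have "det (four_block_mat (A - B * W * C) B (0\<^sub>m m n) D) =
      det (A - B * W * C) * det D"
    using assms by (intro det_four_block_mat_lower_left_zero) (auto intro!: minus_carrier_mat)
  ultimately show ?thesis by simp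
qed

text \<open>The Schur complement in kernel form. The remaining matrix is again an
  \<open>fmat\<close>, with a corrected kernel, so the step can be repeated.\<close>

lemma det_fmat_append:
  fixes f :: "'a \<Rightarrow> 'a \<Rightarrow> 'b::idom"
  assumes "distinct bs" and "fmat f bs bs * fmat g bs bs = 1\<^sub>m (length bs)"
  shows "det (fmat f (us @ bs) (us @ bs)) = det (fmat f bs bs) *
    det (fmat (\<lambda>u v. f u v - (\<Sum>c\<in>set bs. \<Sum>d\<in>set bs. f u c * g c d * f d v)) us us)"
proof -
  have "fmat f us us - fmat f us bs * fmat g bs bs * fmat f bs us =
      fmat (\<lambda>u v. f u v - (\<Sum>c\<in>set bs. \<Sum>d\<in>set bs. f u c * g c d * f d v)) us us"
    using assms(1)
    by (simp add: fmat_mult, intro eq_matI)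
      (auto simp: sum_distrib_right intro: sum.swap)
  then show ?thesis
    using assms(2) by (simp add: fmat_append det_schur_complement[OF dim_fmat(3) dim_fmat(3)
          dim_fmat(3) dim_fmat(3) dim_fmat(3) assms(2)])
qed

text \<open>The tail blocks are eliminated first, with the head block counted among the remaining
  rows; this is why \<open>us\<close> must be general in the induction. As \<open>f\<close> vanishes
  between different blocks, the corrections from the tail leave every row and column of the head
  block unchanged (\<open>fl\<close>, \<open>fr\<close>), so the inverse \<open>g k\<close> still
  fits when that block is eliminated in turn.\<close>

lemma det_fmat_blocks:
  fixes f :: "'a \<Rightarrow> 'a \<Rightarrow> 'b::idom" and bs :: "'k \<Rightarrow> 'a list"
  assumes "distinct ks" and "\<And>k. k \<in> set ks \<Longrightarrow> distinct (bs k)"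
    and "\<And>k. k \<in> set ks \<Longrightarrow> fmat f (bs k) (bs k) * fmat (g k) (bs k) (bs k) = 1\<^sub>m (length (bs k))"
    and "\<And>k k' c d. k \<in> set ks \<Longrightarrow> k' \<in> set ks \<Longrightarrow> k \<noteq> k' \<Longrightarrow> c \<in> set (bs k) \<Longrightarrow> d \<in> set (bs k') \<Longrightarrow>
      f c d = 0"
  shows "det (fmat f (us @ concat (map bs ks)) (us @ concat (map bs ks))) =
    (\<Prod>k\<in>set ks. det (fmat f (bs k) (bs k))) *
    det (fmat (\<lambda>u v. f u v -
      (\<Sum>k\<in>set ks. \<Sum>c\<in>set (bs k). \<Sum>d\<in>set (bs k). f u c * g k c d * f d v)) us us)"
  using assms
proof (induction ks arbitrary: us)
  case Nil
  then show ?case by simp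
next
  case (Cons k ks)
  let ?S = "\<lambda>ks u v. \<Sum>k\<in>set ks. \<Sum>c\<in>set (bs k). \<Sum>d\<in>set (bs k). f u c * g k c d * f d v"
  let ?f = "\<lambda>u v. f u v - ?S ks u v"
  have z: "f c d = 0" if "c \<in> set (bs k)" "k' \<in> set ks" "d \<in> set (bs k')" for c d k'
    using that Cons.prems(1) by (intro Cons.prems(4)[of k k']) auto
  have z': "f d c = 0" if "c \<in> set (bs k)" "k' \<in> set ks" "d \<in> set (bs k')" for c d k'
    using that Cons.prems(1) by (intro Cons.prems(4)[of k' k]) auto
  have fl: "?f c v = f c v" if "c \<in> set (bs k)" for c v
    using z[OF that] by simp
  have fr: "?f u c = f u c" if "c \<in> set (bs k)" for c u
    using z'[OF that] by simp
  have eq: "fmat ?f (bs k) (bs k) = fmat f (bs k) (bs k)"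
    by (rule fmat_cong) (rule fl)
  have "det (fmat f (us @ concat (map bs (k # ks))) (us @ concat (map bs (k # ks)))) =
      det (fmat f ((us @ bs k) @ concat (map bs ks)) ((us @ bs k) @ concat (map bs ks)))"
    by simp
  also have "\<dots> = (\<Prod>k\<in>set ks. det (fmat f (bs k) (bs k))) * det (fmat ?f (us @ bs k) (us @ bs k))"
    using Cons.prems(1-3) by (intro Cons.IH Cons.prems(4)) auto
  also have "det (fmat ?f (us @ bs k) (us @ bs k)) = det (fmat f (bs k) (bs k)) *
      det (fmat (\<lambda>u v. ?f u v - (\<Sum>c\<in>set (bs k). \<Sum>d\<in>set (bs k). ?f u c * g k c d * ?f d v)) us us)"
    using Cons.prems(2,3) by (subst det_fmat_append[where g = "g k"]) (auto simp: eq)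
  also have "fmat (\<lambda>u v. ?f u v - (\<Sum>c\<in>set (bs k). \<Sum>d\<in>set (bs k). ?f u c * g k c d * ?f d v)) us us =
      fmat (\<lambda>u v. f u v - ?S (k # ks) u v) us us"
  proof (rule fmat_cong)
    fix u v
    have "(\<Sum>c\<in>set (bs k). \<Sum>d\<in>set (bs k). ?f u c * g k c d * ?f d v) =
        (\<Sum>c\<in>set (bs k). \<Sum>d\<in>set (bs k). f u c * g k c d * f d v)"
      by (intro sum.cong refl arg_cong2[where f = "(*)"] fl fr)
    then show "?f u v - (\<Sum>c\<in>set (bs k). \<Sum>d\<in>set (bs k). ?f u c * g k c d * ?f d v) =
        f u v - ?S (k # ks) u v"
      using Cons.prems(1) by (simp add: algebra_simps)
  qed
  finally show ?case
    using Cons.prems(1) by (simp add: mult_ac)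
qed

lemma minverse:
  fixes A :: "'a::field mat"
  assumes "A \<in> carrier_mat n n" and "det A \<noteq> 0"
  shows "minverse A \<in> carrier_mat n n" "A * minverse A = 1\<^sub>m n" "minverse A * A = 1\<^sub>m n"
proof -
  have "mat_inverse A \<noteq> None"
    using mat_inverse(1)[OF assms(1), where b = "()"]
      det_non_zero_imp_unit[OF assms, where b = "()"] by blast
  then obtain M where M: "mat_inverse A = Some M" by blast
  show "minverse A \<in> carrier_mat n n" "A * minverse A = 1\<^sub>m n" "minverse A * A = 1\<^sub>m n"
    using mat_inverse(2)[OF assms(1) M] by (simp_all add: minverse_def M)
qed

section \<open>Determinants of Kronecker sums\<close>

lemma distinct_concat_map:
  assumes "distinct ks" and "\<And>k. k \<in> set ks \<Longrightarrow> distinct (f k)"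
    and "\<And>k k'. k \<in> set ks \<Longrightarrow> k' \<in> set ks \<Longrightarrow> k \<noteq> k' \<Longrightarrow> set (f k) \<inter> set (f k') = {}"
  shows "distinct (concat (map f ks))"
  using assms
proof (induction ks)
  case (Cons k ks)
  have "distinct (concat (map f ks))"
    using Cons.prems(1,2) by (intro Cons.IH Cons.prems(3)) auto
  moreover have "set (f k) \<inter> set (f k') = {}" if "k' \<in> set ks" for k'
    using Cons.prems(1) that by (intro Cons.prems(3)) auto
  ultimately show ?case using Cons.prems(2) by auto
qed simp

text \<open>This is the row order of a Kronecker product whose second factor has size
  \<open>m\<close>. Along this list Kronecker products become kernels on pairs.\<close>

definition index_pairs :: "nat \<Rightarrow> nat \<Rightarrow> (nat \<times> nat) list" where
  "index_pairs n m = map (\<lambda>k. (k div m, k mod m)) [0..<n * m]"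

lemma index_pairs [simp]:
  "length (index_pairs n m) = n * m"
  "k < n * m \<Longrightarrow> index_pairs n m ! k = (k div m, k mod m)"
  by (simp_all add: index_pairs_def)

lemma distinct_index_pairs: "distinct (index_pairs n m)"
  by (auto simp: index_pairs_def distinct_map inj_on_def) (metis div_mult_mod_eq)

lemma set_index_pairs: "set (index_pairs n m) = {..<n} \<times> {..<m}"
proof (intro equalityI subsetI)
  fix x assume "x \<in> {..<n} \<times> {..<m}"
  then obtain j p where x: "x = (j, p)" "j < n" "p < m" by auto
  have "j * m + p < n * m"
    using x by (metis Suc_leI add.commute less_le_trans mult_Suc mult_le_mono1 nat_add_left_cancel_less)
  moreover have "x = ((j * m + p) div m, (j * m + p) mod m)" using x by simp
  ultimately show "x \<in> set (index_pairs n m)"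
    unfolding index_pairs_def
    by (metis (no_types, lifting) atLeast0LessThan imageI lessThan_iff list.set_map set_upt)
next
  fix x assume "x \<in> set (index_pairs n m)"
  then show "x \<in> {..<n} \<times> {..<m}"
    by (cases "m = 0") (auto simp: index_pairs_def less_mult_imp_div_less)
qed

lemma kronecker_index:
  assumes "A \<in> carrier_mat n n'" "B \<in> carrier_mat m m'" "p < n * m" "q < n' * m'"
  shows "kronecker A B $$ (p, q) = A $$ (p div m, q div m') * B $$ (p mod m, q mod m')"
  using assms by (simp add: kronecker_def)

lemma det_fmat_block_diagonal:
  fixes f :: "'a \<Rightarrow> 'a \<Rightarrow> 'b::idom"
  assumes "distinct ks"
    and "\<And>k k' c d. k \<in> set ks \<Longrightarrow> k' \<in> set ks \<Longrightarrow> k \<noteq> k' \<Longrightarrow> c \<in> set (bs k) \<Longrightarrow> d \<in> set (bs k') \<Longrightarrow>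
      f c d = 0"
  shows "det (fmat f (concat (map bs ks)) (concat (map bs ks))) =
    (\<Prod>k\<in>set ks. det (fmat f (bs k) (bs k)))"
  using assms
proof (induction ks)
  case Nil
  then show ?case by (simp add: fmat_def)
next
  case (Cons k ks)
  let ?c = "concat (map bs ks)"
  have "f c d = 0" if c: "c \<in> set (bs k)" and d: "d \<in> set ?c" for c d
  proof -
    obtain k' where "k' \<in> set ks" "d \<in> set (bs k')" using d by auto
    then show ?thesis using Cons.prems(1) c by (intro Cons.prems(2)[of k k']) auto
  qed
  then have z: "fmat f (bs k) ?c = 0\<^sub>m (length (bs k)) (length ?c)"
    by (intro eq_matI) (simp_all add: nth_mem del: set_concat)
  have "det (fmat f (bs k @ ?c) (bs k @ ?c)) = det (fmat f (bs k) (bs k)) * det (fmat f ?c ?c)"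
    unfolding fmat_append
    by (rule det_four_block_mat_upper_right_zero[OF dim_fmat(3) z dim_fmat(3) dim_fmat(3)])
  moreover have "det (fmat f ?c ?c) = (\<Prod>k\<in>set ks. det (fmat f (bs k) (bs k)))"
    using Cons.prems(1) by (intro Cons.IH Cons.prems(2)) auto
  ultimately show ?case using Cons.prems(1) by simp
qed

text \<open>Collapses the sums that arise on multiplying by a Kronecker product with the identity,
  whose entries vanish unless the second coordinates agree.\<close>

lemma sum_pairs_delta:
  assumes "p < (m::nat)"
  shows "(\<Sum>y\<in>{..<n::nat} \<times> {..<m}. (if snd y = p then h y else 0)) = (\<Sum>j<n. h (j, p))"
proof -
  have "(\<Sum>y\<in>{..<n} \<times> {..<m}. (if snd y = p then h y else 0)) =
      (\<Sum>j<n. \<Sum>q<m. if q = p then h (j, q) else 0)"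
    unfolding sum.cartesian_product by (intro sum.cong) auto
  then show ?thesis using assms by simp
qed

lemma mult_mat_index:
  fixes A :: "'a::semiring_0 mat"
  assumes "A \<in> carrier_mat a n" "B \<in> carrier_mat n c" "i < a" "k < c"
  shows "(A * B) $$ (i, k) = (\<Sum>j<n. A $$ (i, j) * B $$ (j, k))"
  using assms by (auto simp: scalar_prod_def atLeast0LessThan)

text \<open>Conjugation by the Kronecker product of \<open>U\<close> with the identity diagonalises
  every \<open>A i\<close> at once. Condition \<open>DR\<close> asks that the Kronecker product of
  \<open>D i\<close> and \<open>R i\<close> act like that of a scalar matrix and \<open>R i\<close>;
  it holds both when \<open>D i\<close> is scalar and when \<open>R i\<close> is zero.\<close>

lemma det_kronecker_diagonal:
  fixes X :: "'a::idom mat" and N R A D :: "nat \<Rightarrow> 'a mat"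
  assumes X: "X \<in> carrier_mat m m"
    and N: "\<And>i. i < t \<Longrightarrow> N i \<in> carrier_mat m m" and R: "\<And>i. i < t \<Longrightarrow> R i \<in> carrier_mat m m"
    and A: "\<And>i. i < t \<Longrightarrow> A i \<in> carrier_mat n n" and D: "\<And>i. i < t \<Longrightarrow> D i \<in> carrier_mat n n"
    and U: "U \<in> carrier_mat n n" "V \<in> carrier_mat n n" "U * V = 1\<^sub>m n"
    and diag: "\<And>i j k. i < t \<Longrightarrow> j < n \<Longrightarrow> k < n \<Longrightarrow>
      (U * A i * V) $$ (j, k) = (if j = k then \<theta> i j else 0)"
    and DR: "\<And>i j k p q. i < t \<Longrightarrow> j < n \<Longrightarrow> k < n \<Longrightarrow> p < m \<Longrightarrow> q < m \<Longrightarrow>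
      D i $$ (j, k) * R i $$ (p, q) = (if j = k then \<delta> i * R i $$ (p, q) else 0)"
  shows "det (kronecker (1\<^sub>m n) X - sum_mats (n * m) (n * m)
      (\<lambda>i. kronecker (A i) (N i) + kronecker (D i) (R i)) {..<t}) =
    (\<Prod>j<n. det (X - sum_mats m m (\<lambda>i. \<delta> i \<cdot>\<^sub>m R i + \<theta> i j \<cdot>\<^sub>m N i) {..<t}))"
\<comment> \<open>For \<open>m = 0\<close> all matrices are empty and both sides are 1. Otherwise
  remainders modulo \<open>m\<close> are valid indices.\<close>
proof (cases "m = 0")
  case True
  have "sum_mats 0 0 f {..<t} \<in> carrier_mat 0 0" for f :: "nat \<Rightarrow> 'a mat"
    by (simp add: sum_mats_def)
  then have "det (M - sum_mats 0 0 f {..<t}) = 1" for f and M :: "'a mat"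
    by (intro det_dim_zero minus_carrier_mat)
  then show ?thesis using True by simp
next
  case False
  then have m: "m > 0" by simp
  let ?us = "index_pairs n m"
  note dist = distinct_index_pairs[of n m] and us = set_index_pairs[of n m]
  let ?P = "{..<n} \<times> {..<m}"
  \<comment> \<open>By \<open>DR\<close> the degree terms are block diagonal with equal blocks. They
    are merged with \<open>X\<close> into a part that commutes with the conjugation.\<close>
  let ?X = "\<lambda>p q. X $$ (p, q) - (\<Sum>i<t. \<delta> i * R i $$ (p, q))"
  define F where "F x y = (if fst x = fst y then ?X (snd x) (snd y) else 0) -
    (\<Sum>i<t. A i $$ (fst x, fst y) * N i $$ (snd x, snd y))" for x y
  define F' where "F' x y = (if fst x = fst y then ?X (snd x) (snd y) -
    (\<Sum>i<t. \<theta> i (fst x) * N i $$ (snd x, snd y)) else 0)" for x y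
  \<comment> \<open>\<open>E M\<close> is the kernel of the Kronecker product of \<open>M\<close>
    with the identity. Conjugating by \<open>E U\<close> and \<open>E V\<close> turns
    \<open>F\<close> into \<open>F'\<close>.\<close>
  define E where "E M x y = (if snd y = snd x then M $$ (fst x, fst y) else 0)"
    for M :: "'a mat" and x y :: "nat \<times> nat"
  have div: "k div m < n" if "k < n * m" for k
    using that by (simp add: less_mult_imp_div_less)
  have M: "kronecker (1\<^sub>m n) X - sum_mats (n * m) (n * m)
      (\<lambda>i. kronecker (A i) (N i) + kronecker (D i) (R i)) {..<t} = fmat F ?us ?us"
  proof (rule eq_matI)
    fix p q assume "p < dim_row (fmat F ?us ?us)" "q < dim_col (fmat F ?us ?us)"
    then have pq: "p < n * m" "q < n * m" by auto
    then have l: "p div m < n" "q div m < n" "p mod m < m" "q mod m < m"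
      using div m by auto
    have *: "(kronecker (A i) (N i) + kronecker (D i) (R i)) $$ (p, q) =
        A i $$ (p div m, q div m) * N i $$ (p mod m, q mod m) +
        (if p div m = q div m then \<delta> i * R i $$ (p mod m, q mod m) else 0)" if "i < t" for i
    proof -
      have "dim_row (kronecker (D i) (R i)) = n * m" "dim_col (kronecker (D i) (R i)) = n * m"
        using D[OF that] R[OF that] by (auto simp: kronecker_def)
      then show ?thesis
        using pq l kronecker_index[OF A[OF that] N[OF that] pq] kronecker_index[OF D[OF that] R[OF that] pq]
          DR[OF that l] by simp
    qed
    have "kronecker (1\<^sub>m n) X $$ (p, q) = (if p div m = q div m then X $$ (p mod m, q mod m) else 0)"
      using l kronecker_index[OF one_carrier_mat X pq] by simp
    then show "(kronecker (1\<^sub>m n) X - sum_mats (n * m) (n * m)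
      (\<lambda>i. kronecker (A i) (N i) + kronecker (D i) (R i)) {..<t}) $$ (p, q) = fmat F ?us ?us $$ (p, q)"
      using pq by (simp add: sum_mats_def * F_def sum.distrib)
  qed (auto simp: sum_mats_def)
  have E: "(\<Sum>y\<in>?P. E U x y * G y) = (\<Sum>j<n. U $$ (fst x, j) * G (j, snd x))"
    "(\<Sum>y\<in>?P. G y * E V y x) = (\<Sum>j<n. G (j, snd x) * V $$ (j, fst x))"
    if "snd x < m" for x G
    using sum_pairs_delta[OF that, of "\<lambda>y. U $$ (fst x, fst y) * G y" n]
      sum_pairs_delta[OF that, of "\<lambda>y. G y * V $$ (fst y, fst x)" n]
    by (simp_all add: E_def if_distrib[of "\<lambda>x. x * _"] if_distrib[of "\<lambda>x. _ * x"]
        eq_commute[of "snd x"] cong: if_cong)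
  have dist_diff: "(u * x - (\<Sum>i<t. f i * g i)) * v = u * v * x - (\<Sum>i<t. f i * v * g i)"
    for u x v :: 'a and f g :: "nat \<Rightarrow> 'a"
    by (simp add: algebra_simps sum_distrib_right sum_distrib_left)
  have UV: "(\<Sum>i<n. U $$ (j, i) * V $$ (i, k)) = (if j = k then 1 else 0)" if "j < n" "k < n" for j k
    using mult_mat_index[OF U(1,2) that] U(3) that by simp
  have UAV: "(\<Sum>k'<n. (\<Sum>j'<n. U $$ (j, j') * A i $$ (j', k')) * V $$ (k', k)) =
      (if j = k then \<theta> i j else 0)" if "i < t" "j < n" "k < n" for i j k
    using mult_mat_index[OF mult_carrier_mat[OF U(1) A[OF that(1)]] U(2) that(2,3)]
      mult_mat_index[OF U(1) A[OF that(1)] that(2)] diag[OF that] by simp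
  have "fmat (E U) ?us ?us * fmat (E V) ?us ?us = 1\<^sub>m (length ?us)"
    unfolding fmat_mult[OF dist] fmat_one[OF dist, symmetric] us
  proof (rule fmat_cong, unfold us)
    fix x z assume x: "x \<in> ?P" and z: "z \<in> ?P"
    then have l: "fst x < n" "fst z < n" "snd x < m" by auto
    have "(\<Sum>y\<in>?P. E U x y * E V y z) = (\<Sum>j<n. U $$ (fst x, j) * (if snd z = snd x then V $$ (j, fst z) else 0))"
      unfolding E(1)[OF l(3)] by (simp add: E_def cong: if_cong)
    also have "\<dots> = (if x = z then 1 else 0)"
      using UV[OF l(1,2)] by (cases "snd z = snd x") (auto simp: prod_eq_iff)
    finally show "(\<Sum>y\<in>?P. E U x y * E V y z) = (if x = z then 1 else 0)" .
  qed
  then have "det (fmat F ?us ?us) = det (fmat (E U) ?us ?us * fmat F ?us ?us * fmat (E V) ?us ?us)"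
    by (rule det_similar[OF dim_fmat(3) dim_fmat(3) dim_fmat(3), symmetric])
  also have "fmat (E U) ?us ?us * fmat F ?us ?us * fmat (E V) ?us ?us = fmat F' ?us ?us"
    unfolding fmat_mult[OF dist] us
  proof (rule fmat_cong, unfold us)
    fix x z assume x: "x \<in> ?P" and z: "z \<in> ?P"
    then have l: "fst x < n" "fst z < n" "snd x < m" "snd z < m" by auto
    let ?A = "\<lambda>i j k. A i $$ (j, k)" and ?N = "\<lambda>i. N i $$ (snd x, snd z)"
    have "(\<Sum>y\<in>?P. (\<Sum>w\<in>?P. E U x w * F w y) * E V y z) =
        (\<Sum>k<n. (\<Sum>j<n. U $$ (fst x, j) * F (j, snd x) (k, snd z)) * V $$ (k, fst z))"
      by (simp add: E l)
    \<comment> \<open>In the inner sum the block diagonal part of \<open>F\<close> survives only at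
      \<open>j = k\<close>. The outer sum then forms \<open>U * V\<close> in front of
      \<open>?X\<close> and \<open>U * A i * V\<close> in front of \<open>?N i\<close>.\<close>
    also have "\<dots> = (\<Sum>k<n. (U $$ (fst x, k) * ?X (snd x) (snd z) -
        (\<Sum>i<t. (\<Sum>j<n. U $$ (fst x, j) * ?A i j k) * ?N i)) * V $$ (k, fst z))"
    proof (intro sum.cong refl arg_cong2[where f = "(*)"])
      fix k assume k: "k \<in> {..<n}"
      have "(\<Sum>j<n. U $$ (fst x, j) * F (j, snd x) (k, snd z)) =
          (\<Sum>j<n. (if j = k then U $$ (fst x, k) * ?X (snd x) (snd z) else 0) -
            (\<Sum>i<t. U $$ (fst x, j) * ?A i j k * ?N i))"
        by (intro sum.cong refl) (simp add: F_def right_diff_distrib sum_distrib_left mult.assoc)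
      also have "\<dots> = U $$ (fst x, k) * ?X (snd x) (snd z) -
          (\<Sum>j<n. \<Sum>i<t. U $$ (fst x, j) * ?A i j k * ?N i)"
        using k by (simp add: sum_subtractf)
      also have "(\<Sum>j<n. \<Sum>i<t. U $$ (fst x, j) * ?A i j k * ?N i) =
          (\<Sum>i<t. (\<Sum>j<n. U $$ (fst x, j) * ?A i j k) * ?N i)"
        unfolding sum_distrib_right by (rule sum.swap)
      finally show "(\<Sum>j<n. U $$ (fst x, j) * F (j, snd x) (k, snd z)) =
        U $$ (fst x, k) * ?X (snd x) (snd z) - (\<Sum>i<t. (\<Sum>j<n. U $$ (fst x, j) * ?A i j k) * ?N i)" .
    qed
    also have "\<dots> = (\<Sum>k<n. U $$ (fst x, k) * V $$ (k, fst z)) * ?X (snd x) (snd z) -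
        (\<Sum>k<n. \<Sum>i<t. (\<Sum>j<n. U $$ (fst x, j) * ?A i j k) * V $$ (k, fst z) * ?N i)"
      unfolding sum_distrib_right[of _ _ "?X (snd x) (snd z)"] sum_subtractf[symmetric]
      by (intro sum.cong refl) (rule dist_diff)
    also have "(\<Sum>k<n. \<Sum>i<t. (\<Sum>j<n. U $$ (fst x, j) * ?A i j k) * V $$ (k, fst z) * ?N i) =
        (\<Sum>i<t. (\<Sum>k<n. (\<Sum>j<n. U $$ (fst x, j) * ?A i j k) * V $$ (k, fst z)) * ?N i)"
      by (subst sum.swap) (simp only: sum_distrib_right)
    also have "\<dots> = (\<Sum>i<t. (if fst x = fst z then \<theta> i (fst x) else 0) * ?N i)"
      using l by (intro sum.cong refl) (simp add: UAV)
    finally show "(\<Sum>y\<in>?P. (\<Sum>w\<in>?P. E U x w * F w y) * E V y z) = F' x z"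
      using l by (simp add: UV F'_def)
  qed
  \<comment> \<open>The index list is rewritten as a concatenation of blocks with constant first
    coordinate; \<open>F'\<close> vanishes between different blocks.\<close>
  also have "det (fmat F' ?us ?us) =
      det (fmat F' (concat (map (\<lambda>j. map (Pair j) [0..<m]) [0..<n])) (concat (map (\<lambda>j. map (Pair j) [0..<m]) [0..<n])))"
  proof (rule det_fmat_reorder[OF dist])
    show "distinct (concat (map (\<lambda>j. map (Pair j) [0..<m]) [0..<n]))"
      by (rule distinct_concat_map) (auto simp: distinct_map inj_on_def)
    show "set ?us = set (concat (map (\<lambda>j. map (Pair j) [0..<m]) [0..<n]))"
      unfolding us by auto
  qed
  also have "\<dots> = (\<Prod>j<n. det (fmat F' (map (Pair j) [0..<m]) (map (Pair j) [0..<m])))"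
    by (subst det_fmat_block_diagonal) (auto simp: F'_def atLeast0LessThan)
  also have "\<dots> = (\<Prod>j<n. det (X - sum_mats m m (\<lambda>i. \<delta> i \<cdot>\<^sub>m R i + \<theta> i j \<cdot>\<^sub>m N i) {..<t}))"
  proof (intro prod.cong refl arg_cong[where f = det])
    fix j
    show "fmat F' (map (Pair j) [0..<m]) (map (Pair j) [0..<m]) =
        X - sum_mats m m (\<lambda>i. \<delta> i \<cdot>\<^sub>m R i + \<theta> i j \<cdot>\<^sub>m N i) {..<t}"
      unfolding fmat_map
    proof (rule eq_matI)
      fix p q assume "p < dim_row (X - sum_mats m m (\<lambda>i. \<delta> i \<cdot>\<^sub>m R i + \<theta> i j \<cdot>\<^sub>m N i) {..<t})"
        "q < dim_col (X - sum_mats m m (\<lambda>i. \<delta> i \<cdot>\<^sub>m R i + \<theta> i j \<cdot>\<^sub>m N i) {..<t})"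
      then have pq: "p < m" "q < m" by (simp_all add: sum_mats_def)
      have "(\<delta> i \<cdot>\<^sub>m R i + \<theta> i j \<cdot>\<^sub>m N i) $$ (p, q) = \<delta> i * R i $$ (p, q) + \<theta> i j * N i $$ (p, q)"
        if "i < t" for i
        using pq N[OF that] R[OF that] by auto
      then show "fmat (\<lambda>x y. F' (j, x) (j, y)) [0..<m] [0..<m] $$ (p, q) =
          (X - sum_mats m m (\<lambda>i. \<delta> i \<cdot>\<^sub>m R i + \<theta> i j \<cdot>\<^sub>m N i) {..<t}) $$ (p, q)"
        using pq X by (simp add: sum_mats_def F'_def sum.distrib)
    qed (simp_all add: sum_mats_def)
  qed
  finally show ?thesis unfolding M .
qed

section \<open>Characteristic matrices of graphs\<close>

definition ind :: "'a pair_pre_digraph \<Rightarrow> 'a \<Rightarrow> 'a \<Rightarrow> ratfun" where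
  "ind G x y = (if (x, y) \<in> parcs G then 1 else 0)"

text \<open>The kernel of xI - G over the rational functions. Being a function of vertices, it does
  not depend on how they are listed.\<close>

definition char_entry :: "'a pair_pre_digraph \<Rightarrow> 'a \<Rightarrow> 'a \<Rightarrow> ratfun" where
  "char_entry G x y = (if x = y then ratvar else 0) - ind G x y"

lemma ratconst_hom: "comm_ring_hom ratconst"
  by unfold_locales (auto simp: ratconst_def simp flip: to_fract_add to_fract_mult one_pCons)

lemma ratconst_simps [simp]: "ratconst 0 = 0" "ratconst 1 = 1"
  using ratconst_hom by (simp_all add: ratconst_def flip: one_pCons)

lemma ratconst_of_nat: "ratconst (of_nat k) = of_nat k"
proof -
  interpret comm_ring_hom ratconst by (rule ratconst_hom)
  show ?thesis by (induction k) (simp_all add: hom_add)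
qed

lemma lift_mat_mult:
  "A \<in> carrier_mat a n \<Longrightarrow> C \<in> carrier_mat n c \<Longrightarrow> lift_mat (A * C) = lift_mat A * lift_mat C"
proof -
  interpret comm_ring_hom ratconst by (rule ratconst_hom)
  assume "A \<in> carrier_mat a n" "C \<in> carrier_mat n c"
  then show ?thesis unfolding lift_mat_def by (rule mat_hom_mult)
qed

lemma lift_adjacency_block:
  "lift_mat (adjacency_block G us ws) = fmat (ind G) us ws"
  by (intro eq_matI) (auto simp: lift_mat_def adjacency_block_def ind_def)

lemma char_matrix_adjacency:
  assumes "distinct ws"
  shows "ratvar \<cdot>\<^sub>m 1\<^sub>m (length ws) - lift_mat (adjacency_matrix G ws) =
     fmat (char_entry G) ws ws"
proof (rule eq_matI)
  fix p q assume "p < dim_row (fmat (char_entry G) ws ws)" "q < dim_col (fmat (char_entry G) ws ws)"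
  then have "p < length ws" "q < length ws" by auto
  moreover from this have "ws ! p = ws ! q \<longleftrightarrow> p = q"
    using assms by (auto simp: nth_eq_iff_index_eq)
  ultimately show "(ratvar \<cdot>\<^sub>m 1\<^sub>m (length ws) - lift_mat (adjacency_matrix G ws)) $$ (p, q) =
      fmat (char_entry G) ws ws $$ (p, q)"
    unfolding adjacency_matrix_def lift_adjacency_block char_entry_def
    by (cases "p = q") simp_all
qed (simp_all add: adjacency_matrix_def adjacency_block_def lift_mat_def)

lemma char_poly_adjacency:
  assumes "distinct ws"
  shows "to_fract (char_poly (adjacency_matrix G ws)) = det (fmat (char_entry G) ws ws)"
proof -
  have c: "adjacency_matrix G ws \<in> carrier_mat (length ws) (length ws)"
    by (simp add: adjacency_matrix_def adjacency_block_def)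
  have "to_fract (char_poly (adjacency_matrix G ws)) = rat_phi (lift_mat (adjacency_matrix G ws))"
    using rat_phi_lift_mat[OF c] by simp
  also have "\<dots> = det (fmat (char_entry G) ws ws)"
    using c char_matrix_adjacency[OF assms, of G] by (simp add: rat_phi_def lift_mat_def)
  finally show ?thesis .
qed

lemma pair_graph_sym: "pair_graph G \<Longrightarrow> (x, y) \<in> parcs G \<longleftrightarrow> (y, x) \<in> parcs G"
proof -
  assume "pair_graph G"
  then interpret pair_graph G .
  show ?thesis using pair_sym_arcs by (auto simp: symmetric_def sym_def)
qed

lemma pair_graph_irrefl: "pair_graph G \<Longrightarrow> (x, x) \<notin> parcs G"
proof -
  assume "pair_graph G"
  then interpret pair_graph G .
  show ?thesis using pair_no_loops by fastforce
qed

lemma pair_graph_wf: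
  assumes "pair_graph G" "(x, y) \<in> parcs G"
  shows "x \<in> pverts G" "y \<in> pverts G"
proof -
  interpret pair_graph G by fact
  show "x \<in> pverts G" "y \<in> pverts G"
    using in_arcsD1 in_arcsD2 assms(2) by auto
qed

lemma pair_graph_finite:
  assumes "pair_graph G"
  shows "finite (parcs G)"
proof -
  interpret pair_graph G by fact
  show ?thesis by (rule pair_finite_arcs)
qed

section \<open>The resolvent of a cylinder\<close>

text \<open>The resolvent addressed by inner vertices instead of positions, so that an automorphism
  can act on its arguments.\<close>

definition res_entry :: "'h cylinder \<Rightarrow> 'h \<Rightarrow> 'h \<Rightarrow> ratfun" where
  "res_entry H c d =
     resolvent (Cmat H) $$ (label_of (inner_verts H) c, label_of (inner_verts H) d)"

lemma resolvent:
  assumes "distinct (inner_verts H)"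
  defines "is \<equiv> inner_verts H"
  shows "resolvent (Cmat H) = fmat (res_entry H) is is"
    and "fmat (char_entry (cgraph H)) is is * fmat (res_entry H) is is = 1\<^sub>m (length is)"
    and "fmat (res_entry H) is is * fmat (char_entry (cgraph H)) is is = 1\<^sub>m (length is)"
proof -
  let ?M = "fmat (char_entry (cgraph H)) is is"
  have C: "Cmat H \<in> carrier_mat (length is) (length is)"
    by (simp add: Cmat_def adjacency_matrix_def adjacency_block_def is_def)
  \<comment> \<open>The characteristic polynomial is monic, hence nonzero as a rational function.
    This replaces the condition that x is not an eigenvalue of C.\<close>
  have "char_poly (Cmat H) \<noteq> 0"
    using degree_monic_char_poly[OF C] by auto
  then have "det ?M \<noteq> 0"
    using char_poly_adjacency[OF assms(1), of "cgraph H"] by (auto simp: Cmat_def is_def)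
  note inv = minverse[OF dim_fmat(3) this]
  have R: "resolvent (Cmat H) = minverse ?M"
    using C char_matrix_adjacency[OF assms(1), of "cgraph H"]
    by (simp add: resolvent_def Cmat_def is_def)
  show eq: "resolvent (Cmat H) = fmat (res_entry H) is is"
    using inv(1) assms(1) unfolding R[symmetric]
    by (intro eq_matI) (auto simp: res_entry_def label_of_nth is_def)
  show "?M * fmat (res_entry H) is is = 1\<^sub>m (length is)"
    "fmat (res_entry H) is is * ?M = 1\<^sub>m (length is)"
    using inv(2,3) unfolding eq[symmetric] R by auto
qed

text \<open>One bilinear form on all vertices of the cylinder, whose restrictions to pairs of bases
  are R_d and R_a. Symmetry statements about both matrices then reduce to the invariance of this
  form.\<close>

definition res_form :: "'h cylinder \<Rightarrow> 'h \<Rightarrow> 'h \<Rightarrow> ratfun" where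
  "res_form H x y = (\<Sum>c\<in>set (inner_verts H). \<Sum>d\<in>set (inner_verts H).
     ind (cgraph H) x c * res_entry H c d * ind (cgraph H) y d)"

lemma Rd_Ra_eq:
  fixes H :: "'a cylinder"
  assumes "distinct (inner_verts H)"
  shows "Rd H = fmat (res_form H) (base_verts H) (base_verts H)"
    and "Ra H = fmat (res_form H) (base_verts H) (base_verts' H)"
proof -
  have "fmat f xs (inner_verts H) * resolvent (Cmat H) * transpose_mat (fmat g ys (inner_verts H)) =
      fmat (\<lambda>x y. \<Sum>c\<in>set (inner_verts H). \<Sum>d\<in>set (inner_verts H). f x c * res_entry H c d * g y d) xs ys"
    for f g :: "'a \<Rightarrow> 'a \<Rightarrow> ratfun" and xs ys
    unfolding resolvent(1)[OF assms] fmat_mult[OF assms] transpose_fmat sum_distrib_right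
    by (subst sum.swap) (rule refl)
  then show "Rd H = fmat (res_form H) (base_verts H) (base_verts H)"
    "Ra H = fmat (res_form H) (base_verts H) (base_verts' H)"
    unfolding Rd_def Ra_def Ebc_def Eb'c_def lift_adjacency_block res_form_def by blast+
qed

text \<open>Exchanging the two bases preserves their union, and therefore its complement.\<close>

lemma automorphism_inner_verts:
  assumes "bsymmetric_cylinder B H" and "graph_automorphism (cgraph H) \<sigma>"
    and "map \<sigma> (base_verts H) = base_verts' H" "map \<sigma> (base_verts' H) = base_verts H"
  shows "bij_betw \<sigma> (set (inner_verts H)) (set (inner_verts H))"
proof -
  let ?b = "set (base_verts H) \<union> set (base_verts' H)"
  have "\<sigma> ` ?b = ?b"
    using arg_cong[OF assms(3), of set] arg_cong[OF assms(4), of set] by auto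
  moreover have b: "?b \<subseteq> pverts (cgraph H)" and i: "set (inner_verts H) = pverts (cgraph H) - ?b"
    using assms(1) by (auto simp: bsymmetric_cylinder_def)
  moreover have s: "bij_betw \<sigma> (pverts (cgraph H)) (pverts (cgraph H))"
    using assms(2) by (simp add: graph_automorphism_def)
  ultimately show ?thesis
    unfolding bij_betw_def by (metis Diff_subset inj_on_image_set_diff inj_on_subset subset_refl)
qed

text \<open>Uniqueness of inverses: \<open>char_entry\<close> is invariant under \<sigma>, so the
  resolvent relabelled by \<sigma> is again a right inverse of xI - C. Multiplying by the left
  inverse identifies it with the resolvent.\<close>

lemma res_entry_automorphism:
  assumes "bsymmetric_cylinder B H" and "graph_automorphism (cgraph H) \<sigma>"
    and "map \<sigma> (base_verts H) = base_verts' H" "map \<sigma> (base_verts' H) = base_verts H"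
    and "c \<in> set (inner_verts H)" "d \<in> set (inner_verts H)"
  shows "res_entry H (\<sigma> c) (\<sigma> d) = res_entry H c d"
proof -
  let ?I = "inner_verts H" and ?h = "char_entry (cgraph H)" and ?r = "res_entry H"
  have bij: "bij_betw \<sigma> (set ?I) (set ?I)"
    by (rule automorphism_inner_verts) fact+
  then have inj: "inj_on \<sigma> (set ?I)" and im: "\<sigma> x \<in> set ?I" if "x \<in> set ?I" for x
    using that by (auto simp: bij_betw_def)
  have di: "distinct ?I" and sub: "set ?I \<subseteq> pverts (cgraph H)"
    using assms(1) by (auto simp: bsymmetric_cylinder_def)
  have h: "?h (\<sigma> x) (\<sigma> y) = ?h x y" if "x \<in> set ?I" "y \<in> set ?I" for x y
    using that sub assms(2) inj_on_eq_iff[OF inj[OF that(1)] that]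
    by (auto simp: char_entry_def ind_def graph_automorphism_def subset_iff)
  have inv: "(\<Sum>y\<in>set ?I. ?h x y * ?r y z) = (if x = z then 1 else 0)"
    if "x \<in> set ?I" "z \<in> set ?I" for x z
    using resolvent(2)[OF di] that unfolding fmat_mult[OF di] fmat_one[OF di, symmetric]
    by (rule fmat_eqD)
  have "(\<Sum>y\<in>set ?I. ?h x y * ?r (\<sigma> y) (\<sigma> z)) = (if x = z then 1 else 0)"
    if "x \<in> set ?I" "z \<in> set ?I" for x z
  proof -
    have "(\<Sum>y\<in>set ?I. ?h x y * ?r (\<sigma> y) (\<sigma> z)) = (\<Sum>y\<in>set ?I. ?h (\<sigma> x) (\<sigma> y) * ?r (\<sigma> y) (\<sigma> z))"
      using h that by simp
    also have "\<dots> = (\<Sum>y\<in>set ?I. ?h (\<sigma> x) y * ?r y (\<sigma> z))"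
      by (rule sum.reindex_bij_betw[OF bij])
    also have "\<dots> = (if x = z then 1 else 0)"
      using inv im that inj_on_eq_iff[OF inj[OF that(1)] that] by simp
    finally show ?thesis .
  qed
  then have "fmat ?h ?I ?I * fmat (\<lambda>x y. ?r (\<sigma> x) (\<sigma> y)) ?I ?I = 1\<^sub>m (length ?I)"
    unfolding fmat_mult[OF di] fmat_one[OF di, symmetric] by (intro fmat_cong)
  then have "fmat (\<lambda>x y. ?r (\<sigma> x) (\<sigma> y)) ?I ?I = fmat ?r ?I ?I"
    using resolvent(3)[OF di] left_mult_one_mat[OF dim_fmat(3)] right_mult_one_mat[OF dim_fmat(3)]
      assoc_mult_mat[OF dim_fmat(3) dim_fmat(3) dim_fmat(3)] by metis
  then show ?thesis using assms(5,6) by (rule fmat_eqD)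
qed

text \<open>Both summation variables are replaced by their images under \<sigma>, after which every
  factor is invariant.\<close>

lemma res_form_automorphism:
  assumes "bsymmetric_cylinder B H" and "graph_automorphism (cgraph H) \<sigma>"
    and "map \<sigma> (base_verts H) = base_verts' H" "map \<sigma> (base_verts' H) = base_verts H"
    and "x \<in> pverts (cgraph H)" "y \<in> pverts (cgraph H)"
  shows "res_form H (\<sigma> x) (\<sigma> y) = res_form H x y"
proof -
  let ?I = "set (inner_verts H)" and ?k = "ind (cgraph H)"
  have bij: "bij_betw \<sigma> ?I ?I"
    by (rule automorphism_inner_verts) fact+
  have sub: "?I \<subseteq> pverts (cgraph H)"
    using assms(1) by (auto simp: bsymmetric_cylinder_def)
  have k: "?k (\<sigma> z) (\<sigma> c) = ?k z c" if "z \<in> pverts (cgraph H)" "c \<in> ?I" for z c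
    using that sub assms(2) by (auto simp: ind_def graph_automorphism_def subset_iff)
  have "res_form H (\<sigma> x) (\<sigma> y) =
      (\<Sum>c\<in>?I. \<Sum>d\<in>?I. ?k (\<sigma> x) (\<sigma> c) * res_entry H (\<sigma> c) (\<sigma> d) * ?k (\<sigma> y) (\<sigma> d))"
    unfolding res_form_def by (subst (1 2) sum.reindex_bij_betw[OF bij, symmetric]) simp
  also have "\<dots> = res_form H x y"
    unfolding res_form_def
    by (intro sum.cong refl) (simp add: k assms res_entry_automorphism[OF assms(1-4)])
  finally show ?thesis .
qed

text \<open>These identities make the orientation of an edge irrelevant: R_d is the same from either
  base, R_a is the same in either direction, and, arcs being symmetric, the last one says that
  \<open>Ebb' H\<close> is a symmetric matrix.\<close>

lemma bsymmetric_swap: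
  assumes "bsymmetric_cylinder B H" and "p < length (base_verts H)" "q < length (base_verts H)"
  defines "b \<equiv> base_verts H" and "b' \<equiv> base_verts' H"
  shows "res_form H (b' ! p) (b' ! q) = res_form H (b ! p) (b ! q)"
    and "res_form H (b' ! p) (b ! q) = res_form H (b ! p) (b' ! q)"
    and "(b' ! p, b ! q) \<in> parcs (cgraph H) \<longleftrightarrow> (b ! p, b' ! q) \<in> parcs (cgraph H)"
proof -
  obtain \<sigma> where \<sigma>: "graph_automorphism (cgraph H) \<sigma>"
    "map \<sigma> (base_verts H) = base_verts' H" "map \<sigma> (base_verts' H) = base_verts H"
    using assms(1) by (auto simp: bsymmetric_cylinder_def)
  have len: "length b' = length b"
    using arg_cong[OF \<sigma>(2), of length] by (simp add: b_def b'_def)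
  have s: "\<sigma> (b ! r) = b' ! r" "\<sigma> (b' ! r) = b ! r" if "r < length b" for r
    using that \<sigma>(2,3) len by (metis nth_map b_def b'_def)+
  have v: "b ! r \<in> pverts (cgraph H)" "b' ! r \<in> pverts (cgraph H)" if "r < length b" for r
    using assms(1) that len nth_mem[of r b] nth_mem[of r b']
    by (auto simp: bsymmetric_cylinder_def b_def b'_def)
  have pq: "p < length b" "q < length b" using assms(2,3) by (auto simp: b_def)
  note rf = res_form_automorphism[OF assms(1) \<sigma>]
  show "res_form H (b' ! p) (b' ! q) = res_form H (b ! p) (b ! q)"
    "res_form H (b' ! p) (b ! q) = res_form H (b ! p) (b' ! q)"
    using rf[OF v(1)[OF pq(1)] v(1)[OF pq(2)]] rf[OF v(1)[OF pq(1)] v(2)[OF pq(2)]] s pq by auto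
  show "(b' ! p, b ! q) \<in> parcs (cgraph H) \<longleftrightarrow> (b ! p, b' ! q) \<in> parcs (cgraph H)"
    using \<sigma>(1) v s pq unfolding graph_automorphism_def by metis
qed

section \<open>Oriented graphs\<close>

lemma orientation_cases:
  assumes "pair_graph G" "orientation G A"
  shows "(u, v) \<in> parcs G \<longleftrightarrow> (u, v) \<in> A \<or> (v, u) \<in> A"
  using assms(2) pair_graph_sym[OF assms(1), of u v] unfolding orientation_def by blast

lemma orientation_asym: "orientation G A \<Longrightarrow> (u, v) \<in> A \<Longrightarrow> (v, u) \<notin> A"
  unfolding orientation_def by blast

lemma edge_count_orientation:
  assumes "pair_graph G" "orientation G A"
  shows "edge_count G = card A"
proof -
  have inj: "inj_on (\<lambda>e. {fst e, snd e}) A"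
    using orientation_asym[OF assms(2)] by (auto simp: inj_on_def doubleton_eq_iff)
  have "{{u, v} | u v. (u, v) \<in> parcs G} = (\<lambda>e. {fst e, snd e}) ` A"
    unfolding orientation_cases[OF assms] by (auto simp: image_def insert_commute) force+
  then show ?thesis
    by (simp add: edge_count_def card_image[OF inj])
qed

text \<open>The summand is the coefficient of R_a in block \<open>(u, v)\<close> contributed by the
  cylinder over \<open>e\<close>. An orientation contains exactly one of the two arcs of an edge, so
  nothing is counted twice.\<close>

lemma orientation_adjacency_sum:
  fixes u v :: 'a
  assumes "pair_graph G" "orientation G A"
  shows "(\<Sum>e\<in>A. (if u = fst e \<and> v = snd e then 1 else 0) + (if u = snd e \<and> v = fst e then 1 else 0)) =
    ind G u v"
proof -
  have fin: "finite A"
    using assms pair_graph_finite finite_subset by (auto simp: orientation_def)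
  have "(\<Sum>e\<in>A. if u = fst e \<and> v = snd e then 1 else (0::ratfun)) =
      (\<Sum>e\<in>A. if e = (u, v) then 1 else 0)"
    "(\<Sum>e\<in>A. if u = snd e \<and> v = fst e then 1 else (0::ratfun)) =
      (\<Sum>e\<in>A. if e = (v, u) then 1 else 0)"
    by (intro sum.cong; force)+
  then have "(\<Sum>e\<in>A. (if u = fst e \<and> v = snd e then 1 else 0) + (if u = snd e \<and> v = fst e then 1 else 0)) =
      (if (u, v) \<in> A then 1 else 0) + (if (v, u) \<in> A then 1 else (0::ratfun))"
    unfolding sum.distrib using fin by (simp add: sum.delta)
  also have "\<dots> = ind G u v"
    using orientation_cases[OF assms, of u v] orientation_asym[OF assms(2), of u v]
    by (cases "(u, v) \<in> A"; cases "(v, u) \<in> A") (simp_all add: ind_def)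
  finally show ?thesis .
qed

text \<open>The analogous coefficient of R_d. The arcs leaving \<open>u\<close> are the oriented
  arcs that start there and the reversals of those that end there; asymmetry of the orientation
  keeps the two kinds disjoint.\<close>

lemma orientation_degree_sum:
  fixes u v :: 'a
  assumes "pair_graph G" "orientation G A"
  shows "(\<Sum>e\<in>A. (if u = fst e \<and> v = fst e then 1 else 0) + (if u = snd e \<and> v = snd e then 1 else 0)) =
    (if u = v then of_nat (out_degree (with_proj G) u) else (0::ratfun))"
proof (cases "u = v")
  case True
  have fin: "finite A"
    using assms pair_graph_finite finite_subset by (auto simp: orientation_def)
  let ?F = "{e \<in> A. fst e = u}" and ?S = "prod.swap ` {e \<in> A. snd e = u}"
  have "out_arcs (with_proj G) u = ?F \<union> ?S"
    using orientation_cases[OF assms] by (auto simp: out_arcs_def image_def)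
  moreover have "?F \<inter> ?S = {}"
    using orientation_asym[OF assms(2)] by auto
  ultimately have "out_degree (with_proj G) u = card ?F + card ?S"
    using fin by (simp add: out_degree_def card_Un_disjoint)
  also have "card ?S = card {e \<in> A. snd e = u}"
    by (rule card_image) (auto intro: inj_onI)
  finally have "out_degree (with_proj G) u = card {e \<in> A. fst e = u} + card {e \<in> A. snd e = u}" .
  moreover have "A \<inter> {e. u = fst e} = {e \<in> A. fst e = u}" "A \<inter> {e. u = snd e} = {e \<in> A. snd e = u}"
    by auto
  ultimately show ?thesis
    using fin True by (simp add: sum.distrib sum.If_cases)
next
  case False
  then show ?thesis by (intro trans[OF sum.neutral]) auto
qed

section \<open>The cylindrical construct\<close>

locale cylinder_system =
  fixes t m :: nat and vs :: "'v list" and Gs :: "nat \<Rightarrow> 'v pair_pre_digraph"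
    and B :: "nat pair_pre_digraph" and Hs :: "nat \<Rightarrow> 'h cylinder" and ors :: "nat \<Rightarrow> ('v \<times> 'v) set"
  assumes t: "t \<ge> 1" and vs: "distinct vs"
    and Gs: "i < t \<Longrightarrow> pair_graph (Gs i)" "i < t \<Longrightarrow> pverts (Gs i) = set vs"
    and no_isolated: "i < t \<Longrightarrow> v \<in> set vs \<Longrightarrow> \<exists>w. (v, w) \<in> parcs (Gs i)"
    and edge_disjoint: "i < t \<Longrightarrow> j < t \<Longrightarrow> i \<noteq> j \<Longrightarrow> parcs (Gs i) \<inter> parcs (Gs j) = {}"
    and cyl: "i < t \<Longrightarrow> bsymmetric_cylinder B (Hs i)"
    and m: "card (pverts B) = m" "m > 0"
    and ors: "i < t \<Longrightarrow> orientation (Gs i) (ors i)"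
begin

abbreviation "K \<equiv> cylindrical_construct t ors Hs"
abbreviation "b i \<equiv> base_verts (Hs i)"
abbreviation "b' i \<equiv> base_verts' (Hs i)"
abbreviation "inner i \<equiv> inner_verts (Hs i)"
abbreviation "H i \<equiv> cgraph (Hs i)"

section \<open>Vertices and symmetries of a single cylinder\<close>

lemma lengths: "i < t \<Longrightarrow> length (b i) = m" "i < t \<Longrightarrow> length (b' i) = m"
  using cyl[of i] m(1) unfolding bsymmetric_cylinder_def labelled_copy_def
  by (metis card_lessThan)+

lemma cyl_verts:
  assumes "i < t"
  shows "distinct (b i)" "distinct (b' i)" "distinct (inner i)"
    "set (b i) \<inter> set (b' i) = {}" "set (b i) \<inter> set (inner i) = {}" "set (b' i) \<inter> set (inner i) = {}"
    "pverts (H i) = set (b i) \<union> set (b' i) \<union> set (inner i)"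
  using cyl[OF assms] by (auto simp: bsymmetric_cylinder_def)

lemma H_pair_graph: "i < t \<Longrightarrow> pair_graph (H i)"
  using cyl[of i] by (auto simp: bsymmetric_cylinder_def)

lemma base_arcs:
  assumes "i < t" "p < m" "q < m"
  shows "(b i ! p, b i ! q) \<in> parcs (H i) \<longleftrightarrow> (p, q) \<in> parcs B"
    "(b' i ! p, b' i ! q) \<in> parcs (H i) \<longleftrightarrow> (p, q) \<in> parcs B"
  using cyl[OF assms(1)] lengths[OF assms(1)] assms(2,3)
  unfolding bsymmetric_cylinder_def labelled_copy_def by metis+

lemma swap:
  assumes "i < t" "p < m" "q < m"
  shows "res_form (Hs i) (b' i ! p) (b' i ! q) = res_form (Hs i) (b i ! p) (b i ! q)"
    "res_form (Hs i) (b' i ! p) (b i ! q) = res_form (Hs i) (b i ! p) (b' i ! q)"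
    "(b' i ! p, b i ! q) \<in> parcs (H i) \<longleftrightarrow> (b i ! p, b' i ! q) \<in> parcs (H i)"
  using bsymmetric_swap[OF cyl[OF assms(1)]] assms lengths by auto

lemma ors_arc:
  assumes "i < t" "e \<in> ors i"
  shows "e \<in> parcs (Gs i)" "fst e \<noteq> snd e" "fst e \<in> set vs" "snd e \<in> set vs"
proof -
  show e: "e \<in> parcs (Gs i)" using ors[OF assms(1)] assms(2) by (auto simp: orientation_def)
  show "fst e \<noteq> snd e" "fst e \<in> set vs" "snd e \<in> set vs"
    using e Gs(2)[OF assms(1)] pair_graph_irrefl[OF Gs(1)[OF assms(1)]]
      pair_graph_wf[OF Gs(1)[OF assms(1)], of "fst e" "snd e"] by (cases e; auto)+
qed

section \<open>Placement of cylinder vertices and adjacency in the construct\<close>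

lemma place_base:
  assumes "i < t" "p < m"
  shows "place (Hs i) i e (b i ! p) = BaseVert (fst e) p"
    "place (Hs i) i e (b' i ! p) = BaseVert (snd e) p"
proof -
  have "b i ! p \<in> set (b i)" "b' i ! p \<in> set (b' i)"
    using assms lengths by (auto intro!: nth_mem)
  then show "place (Hs i) i e (b i ! p) = BaseVert (fst e) p"
    "place (Hs i) i e (b' i ! p) = BaseVert (snd e) p"
    using assms cyl_verts[OF assms(1)] lengths[OF assms(1)]
    by (auto simp: place_def label_of_nth)
qed

lemma place_inner: "i < t \<Longrightarrow> c \<in> set (inner i) \<Longrightarrow> place (Hs i) i e c = InnerVert i e c"
  using cyl_verts[of i] by (auto simp: place_def)

lemma cyl_vert_cases:
  assumes "i < t" "x \<in> pverts (H i)"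
  obtains p where "p < m" "x = b i ! p" | p where "p < m" "x = b' i ! p" | "x \<in> set (inner i)"
  using assms cyl_verts(7)[OF assms(1)] lengths[OF assms(1)] by (auto simp: in_set_conv_nth)

text \<open>Together with its counterpart for inner vertices this inverts \<open>place\<close>, so
  that arcs of the construct can be traced back to arcs of a cylinder.\<close>

lemma place_eq_base:
  assumes "i < t" "x \<in> pverts (H i)"
  shows "place (Hs i) i e x = BaseVert u p \<longleftrightarrow>
    p < m \<and> (u = fst e \<and> x = b i ! p \<or> u = snd e \<and> x = b' i ! p)"
proof
  show "p < m \<and> (u = fst e \<and> x = b i ! p \<or> u = snd e \<and> x = b' i ! p)"
    if "place (Hs i) i e x = BaseVert u p"
    using assms(2) by (rule cyl_vert_cases[OF assms(1)])
      (use assms(1) that in \<open>auto simp: place_base place_inner\<close>)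
qed (use assms(1) in \<open>auto simp: place_base\<close>)

lemma place_eq_inner:
  assumes "i < t" "x \<in> pverts (H i)"
  shows "place (Hs i) i e x = InnerVert j f c \<longleftrightarrow> j = i \<and> f = e \<and> c = x \<and> x \<in> set (inner i)"
proof
  show "j = i \<and> f = e \<and> c = x \<and> x \<in> set (inner i)"
    if "place (Hs i) i e x = InnerVert j f c"
    using assms(2) by (rule cyl_vert_cases[OF assms(1)])
      (use assms(1) that in \<open>auto simp: place_base place_inner\<close>)
qed (use assms(1) in \<open>auto simp: place_inner\<close>)

text \<open>The endpoints range explicitly over the vertices of the cylinder, because the inversion
  of \<open>place\<close> is stated for those.\<close>

lemma arc_iff:
  "(x, y) \<in> parcs K \<longleftrightarrow> (\<exists>i<t. \<exists>e\<in>ors i. \<exists>c\<in>pverts (H i). \<exists>d\<in>pverts (H i).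
     (c, d) \<in> parcs (H i) \<and> place (Hs i) i e c = x \<and> place (Hs i) i e d = y)"
proof -
  have "(x, y) \<in> map_prod f f ` S \<longleftrightarrow> (\<exists>c d. (c, d) \<in> S \<and> f c = x \<and> f d = y)"
    for f :: "'h \<Rightarrow> ('v, 'h) construct_vertex" and S
    by force
  then have "(x, y) \<in> parcs K \<longleftrightarrow> (\<exists>i<t. \<exists>e\<in>ors i. \<exists>c d.
      (c, d) \<in> parcs (H i) \<and> place (Hs i) i e c = x \<and> place (Hs i) i e d = y)"
    unfolding cylindrical_construct_def by (simp add: Bex_def)
  then show ?thesis
    using pair_graph_wf[OF H_pair_graph] by meson
qed

lemma K_pair_graph: "pair_graph K"
  using Gs(1) ors cyl by (intro pair_graph_cylindrical_construct[of t Gs ors B Hs]) (auto simp: coherent_def)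

lemma arc_inner_inner:
  assumes "i < t" "e \<in> ors i" "c \<in> set (inner i)" "d \<in> set (inner i)"
  shows "(InnerVert i e c, InnerVert j f d) \<in> parcs K \<longleftrightarrow> i = j \<and> e = f \<and> (c, d) \<in> parcs (H i)"
  unfolding arc_iff using assms cyl_verts(7)[OF assms(1)] by (auto simp: place_eq_inner)

lemma arc_inner_inner':
  "(InnerVert i e c, InnerVert j f d) \<in> parcs K \<Longrightarrow> i = j \<and> e = f"
  unfolding arc_iff by (auto simp: place_eq_inner)

lemma arc_base_inner:
  assumes "i < t" "e \<in> ors i" "d \<in> set (inner i)" "p < m"
  shows "(BaseVert u p, InnerVert i e d) \<in> parcs K \<longleftrightarrow>
    u = fst e \<and> (b i ! p, d) \<in> parcs (H i) \<or> u = snd e \<and> (b' i ! p, d) \<in> parcs (H i)"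
proof -
  have "b i ! p \<in> pverts (H i)" "b' i ! p \<in> pverts (H i)" "d \<in> pverts (H i)"
    using assms cyl_verts(7)[OF assms(1)] lengths[OF assms(1)] by auto
  then show ?thesis
    unfolding arc_iff using assms
    by (auto simp: place_eq_inner place_eq_base) (metis place_base place_inner)+
qed

lemma t_pos: "0 < t" using t by simp

text \<open>Index 0 exists since t \<ge> 1, and its graph has no isolated vertex. Hence some
  cylinder has a base at each vertex \<open>u\<close>, which supplies the block \<open>B\<close> on
  the diagonal at \<open>u\<close>.\<close>

lemma ex_orient_arc: "u \<in> set vs \<Longrightarrow> \<exists>e\<in>ors 0. u = fst e \<or> u = snd e"
  using no_isolated[OF t_pos, of u] unfolding orientation_cases[OF Gs(1)[OF t_pos] ors[OF t_pos]] by force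

lemma arc_base_base:
  assumes "u \<in> set vs" "p < m" "q < m"
  shows "(BaseVert u p, BaseVert v q) \<in> parcs K \<longleftrightarrow>
    u = v \<and> (p, q) \<in> parcs B \<or> (\<exists>i<t. (u, v) \<in> parcs (Gs i) \<and> (b i ! p, b' i ! q) \<in> parcs (H i))"
proof -
  \<comment> \<open>An arc comes from a cylinder in four ways, according to the base holding each
    end. Both bases are copies of \<open>B\<close>, and \<open>swap\<close> exchanges the two mixed
    cases, so two conditions on labels remain.\<close>
  have "(BaseVert u p, BaseVert v q) \<in> parcs K \<longleftrightarrow> (\<exists>i<t. \<exists>e\<in>ors i.
      (u = fst e \<and> v = fst e \<or> u = snd e \<and> v = snd e) \<and> (p, q) \<in> parcs B \<or>
      (u = fst e \<and> v = snd e \<or> u = snd e \<and> v = fst e) \<and> (b i ! p, b' i ! q) \<in> parcs (H i))"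
    (is "_ \<longleftrightarrow> (\<exists>i<t. \<exists>e\<in>ors i. ?P i e)")
  proof
    assume "(BaseVert u p, BaseVert v q) \<in> parcs K"
    then obtain i e c d where ie: "i < t" "e \<in> ors i" and "c \<in> pverts (H i)" "d \<in> pverts (H i)"
      "(c, d) \<in> parcs (H i)" "place (Hs i) i e c = BaseVert u p" "place (Hs i) i e d = BaseVert v q"
      unfolding arc_iff by blast
    then have "u = fst e \<and> c = b i ! p \<or> u = snd e \<and> c = b' i ! p"
      "v = fst e \<and> d = b i ! q \<or> v = snd e \<and> d = b' i ! q" "(c, d) \<in> parcs (H i)"
      by (simp_all add: place_eq_base)
    then have "?P i e"
      using base_arcs[OF ie(1) assms(2,3)] swap(3)[OF ie(1) assms(2,3)]
      by (elim disjE conjE) simp_all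
    then show "\<exists>i<t. \<exists>e\<in>ors i. ?P i e" using ie by blast
  next
    assume "\<exists>i<t. \<exists>e\<in>ors i. ?P i e"
    then obtain i e where ie: "i < t" "e \<in> ors i" and P: "?P i e" by blast
    have "\<exists>c d. (c, d) \<in> parcs (H i) \<and>
        place (Hs i) i e c = BaseVert u p \<and> place (Hs i) i e d = BaseVert v q"
    proof -
      note pl = place_base[OF ie(1) assms(2), of e] place_base[OF ie(1) assms(3), of e]
      note arcs = base_arcs[OF ie(1) assms(2,3)] swap(3)[OF ie(1) assms(2,3)]
      from P consider "u = fst e" "v = fst e" "(p, q) \<in> parcs B"
        | "u = snd e" "v = snd e" "(p, q) \<in> parcs B"
        | "u = fst e" "v = snd e" "(b i ! p, b' i ! q) \<in> parcs (H i)"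
        | "u = snd e" "v = fst e" "(b i ! p, b' i ! q) \<in> parcs (H i)"
        by blast
      then show ?thesis
      proof cases
        case 1
        then show ?thesis using pl arcs by (intro exI[of _ "b i ! p"] exI[of _ "b i ! q"]) simp
      next
        case 2
        then show ?thesis using pl arcs by (intro exI[of _ "b' i ! p"] exI[of _ "b' i ! q"]) simp
      next
        case 3
        then show ?thesis using pl arcs by (intro exI[of _ "b i ! p"] exI[of _ "b' i ! q"]) simp
      next
        case 4
        then show ?thesis using pl arcs by (intro exI[of _ "b' i ! p"] exI[of _ "b i ! q"]) simp
      qed
    qed
    then show "(BaseVert u p, BaseVert v q) \<in> parcs K"
      unfolding arc_iff using ie pair_graph_wf[OF H_pair_graph[OF ie(1)]] by blast
  qed
  moreover have "(\<exists>e\<in>ors i. u = fst e \<and> v = snd e \<or> u = snd e \<and> v = fst e) \<longleftrightarrow> (u, v) \<in> parcs (Gs i)"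
    if "i < t" for i
    unfolding orientation_cases[OF Gs(1)[OF that] ors[OF that]] by force
  moreover have "(\<exists>i<t. \<exists>e\<in>ors i. u = fst e \<and> v = fst e \<or> u = snd e \<and> v = snd e) \<longleftrightarrow> u = v"
    using ex_orient_arc[OF assms(1)] t_pos by blast
  ultimately show ?thesis by blast
qed

lemma construct_verts:
  "pverts K = (\<lambda>(v, p). BaseVert v p) ` (set vs \<times> {..<m}) \<union>
     (\<Union>(i, e)\<in>Sigma {..<t} ors. InnerVert i e ` set (inner i))"
proof (intro equalityI subsetI)
  fix x assume "x \<in> pverts K"
  then obtain i e c where ie: "i < t" "e \<in> ors i" "c \<in> pverts (H i)" "x = place (Hs i) i e c"
    by (auto simp: cylindrical_construct_def)
  show "x \<in> (\<lambda>(v, p). BaseVert v p) ` (set vs \<times> {..<m}) \<union>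
     (\<Union>(i, e)\<in>Sigma {..<t} ors. InnerVert i e ` set (inner i))"
    using ie(3)
    by (rule cyl_vert_cases[OF ie(1)])
      (use ie ors_arc[OF ie(1,2)] in \<open>auto simp: place_base place_inner\<close>)
next
  fix x assume "x \<in> (\<lambda>(v, p). BaseVert v p) ` (set vs \<times> {..<m}) \<union>
     (\<Union>(i, e)\<in>Sigma {..<t} ors. InnerVert i e ` set (inner i))"
  then consider v p where "v \<in> set vs" "p < m" "x = BaseVert v p"
    | i e c where "i < t" "e \<in> ors i" "c \<in> set (inner i)" "x = InnerVert i e c"
    by auto
  then show "x \<in> pverts K"
  proof cases
    case 1
    obtain e where e: "e \<in> ors 0" "v = fst e \<or> v = snd e"
      using ex_orient_arc[OF 1(1)] by blast
    have "b 0 ! p \<in> pverts (H 0)" "b' 0 ! p \<in> pverts (H 0)"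
      using 1(2) cyl_verts(7)[OF t_pos] lengths[OF t_pos] by auto
    then have "x \<in> place (Hs 0) 0 e ` pverts (H 0)"
      using place_base[OF t_pos 1(2), of e] e(2) 1(3) by (metis imageI)
    then show ?thesis using t_pos e(1) unfolding cylindrical_construct_def by fastforce
  next
    case 2
    then have "x \<in> place (Hs i) i e ` pverts (H i)"
      using place_inner[OF 2(1,3), of e] cyl_verts(7)[OF 2(1)] by (metis UnCI imageI)
    then show ?thesis using 2(1,2) unfolding cylindrical_construct_def by fastforce
  qed
qed

section \<open>Entries of the characteristic matrix and the contribution of each cylinder\<close>

abbreviation "n \<equiv> length vs"

text \<open>Adjacency is a 0/1 value while the right side adds contributions. They agree because at
  most one summand is nonzero: there are no loops when \<open>u = v\<close>, and edge-disjointness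
  leaves at most one index \<open>i\<close> when \<open>u\<close> and \<open>v\<close>
  differ.\<close>

lemma char_entry_base_base:
  assumes "u \<in> set vs" "p < m" "q < m"
  shows "char_entry K (BaseVert u p) (BaseVert v q) =
    (if u = v then char_entry B p q else 0) -
    (\<Sum>i<t. ind (Gs i) u v * ind (H i) (b i ! p) (b' i ! q))"
proof -
  have "ind K (BaseVert u p) (BaseVert v q) = (if u = v then ind B p q else 0) +
      (\<Sum>i<t. ind (Gs i) u v * ind (H i) (b i ! p) (b' i ! q))"
  proof (cases "u = v")
    case True
    have "(u, v) \<notin> parcs (Gs i)" if "i < t" for i
      using True pair_graph_irrefl[OF Gs(1)[OF that]] by simp
    then show ?thesis
      using True arc_base_base[OF assms, of v] by (auto simp: ind_def)
  next
    case False
    show ?thesis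
    proof (cases "\<exists>i<t. (u, v) \<in> parcs (Gs i)")
      case True
      then obtain i where i: "i < t" "(u, v) \<in> parcs (Gs i)" by blast
      have j: "(u, v) \<notin> parcs (Gs j)" if "j < t" "j \<noteq> i" for j
        using edge_disjoint[OF i(1) that(1)] that(2) i(2) by blast
      have "(\<Sum>j<t. ind (Gs j) u v * ind (H j) (b j ! p) (b' j ! q)) =
          (\<Sum>j<t. if j = i then ind (H i) (b i ! p) (b' i ! q) else 0)"
        using i j by (intro sum.cong) (auto simp: ind_def)
      also have "\<dots> = ind (H i) (b i ! p) (b' i ! q)"
        using i(1) by simp
      finally show ?thesis
        using False arc_base_base[OF assms, of v] i j by (auto simp: ind_def)
    next
      case no: False
      then have "(\<Sum>j<t. ind (Gs j) u v * ind (H j) (b j ! p) (b' j ! q)) = 0"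
        by (intro sum.neutral) (auto simp: ind_def)
      then show ?thesis
        using False no arc_base_base[OF assms, of v] by (auto simp: ind_def)
    qed
  qed
  then show ?thesis
    by (simp add: char_entry_def)
qed

lemma char_entry_base_inner:
  assumes "i < t" "e \<in> ors i" "c \<in> set (inner i)" "p < m"
  shows "char_entry K (BaseVert u p) (InnerVert i e c) =
      - (if u = fst e then ind (H i) (b i ! p) c else if u = snd e then ind (H i) (b' i ! p) c else 0)"
    and "char_entry K (InnerVert i e c) (BaseVert u p) =
      - (if u = fst e then ind (H i) (b i ! p) c else if u = snd e then ind (H i) (b' i ! p) c else 0)"
  using arc_base_inner[OF assms, of u] ors_arc(2)[OF assms(1,2)]
    pair_graph_sym[OF K_pair_graph, of "InnerVert i e c" "BaseVert u p"]
  by (simp_all add: char_entry_def ind_def)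

lemma char_entry_inner_inner:
  assumes "i < t" "e \<in> ors i" "c \<in> set (inner i)" "d \<in> set (inner i)"
  shows "char_entry K (InnerVert i e c) (InnerVert i e d) = char_entry (H i) c d"
  using arc_inner_inner[OF assms, of i e] by (simp add: char_entry_def ind_def)

text \<open>The minus signs of the two off-diagonal factors cancel. Since the ends of
  \<open>e\<close> differ, each of \<open>u\<close> and \<open>v\<close> meets at most one base, and
  \<open>swap\<close> brings the terms that begin in the second base to those that begin in the
  first.\<close>

lemma cylinder_contribution:
  assumes "i < t" "e \<in> ors i" "p < m" "q < m"
  shows "(\<Sum>c\<in>set (inner i). \<Sum>d\<in>set (inner i). char_entry K (BaseVert u p) (InnerVert i e c) *
      res_entry (Hs i) c d * char_entry K (InnerVert i e d) (BaseVert v q)) =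
    ((if u = fst e \<and> v = snd e then 1 else 0) + (if u = snd e \<and> v = fst e then 1 else 0)) *
      res_form (Hs i) (b i ! p) (b' i ! q) +
    ((if u = fst e \<and> v = fst e then 1 else 0) + (if u = snd e \<and> v = snd e then 1 else 0)) *
      res_form (Hs i) (b i ! p) (b i ! q)"
  (is "?L = ?R")
proof -
  let ?w = "\<lambda>u p c. if u = fst e then ind (H i) (b i ! p) c
    else if u = snd e then ind (H i) (b' i ! p) c else 0"
  have "?L = (\<Sum>c\<in>set (inner i). \<Sum>d\<in>set (inner i). ?w u p c * res_entry (Hs i) c d * ?w v q d)"
    using assms by (intro sum.cong refl)
      (simp only: char_entry_base_inner mult_minus_left mult_minus_right minus_minus)
  also have "\<dots> = ?R"
    using ors_arc(2)[OF assms(1,2)] swap(1,2)[OF assms(1,3,4)]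
    by (cases "u = fst e"; cases "u = snd e"; cases "v = fst e"; cases "v = snd e")
      (simp_all add: res_form_def)
  finally show ?thesis .
qed

lemma cylinder_contributions:
  assumes "i < t" "p < m" "q < m"
  shows "(\<Sum>e\<in>ors i. \<Sum>c\<in>set (inner i). \<Sum>d\<in>set (inner i).
      char_entry K (BaseVert u p) (InnerVert i e c) *
      res_entry (Hs i) c d * char_entry K (InnerVert i e d) (BaseVert v q)) =
    ind (Gs i) u v * res_form (Hs i) (b i ! p) (b' i ! q) +
    (if u = v then of_nat (out_degree (with_proj (Gs i)) u) else 0) * res_form (Hs i) (b i ! p) (b i ! q)"
  unfolding orientation_adjacency_sum[OF Gs(1) ors, OF assms(1) assms(1), symmetric]
    orientation_degree_sum[OF Gs(1) ors, OF assms(1) assms(1), symmetric] sum_distrib_right sum.distrib[symmetric]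
  using assms by (intro sum.cong refl) (rule cylinder_contribution)

section \<open>Elimination of the inner vertices, with the base vertices kept in Kronecker
  order\<close>

definition bverts :: "('v, 'h) construct_vertex list" where
  "bverts = map (\<lambda>(j, p). BaseVert (vs ! j) p) (index_pairs n m)"

lemma bverts: "distinct bverts" "set bverts = (\<lambda>(v, p). BaseVert v p) ` (set vs \<times> {..<m})"
  "length bverts = n * m"
proof -
  show "length bverts = n * m" by (simp add: bverts_def)
  show "distinct bverts"
    using vs distinct_index_pairs
    by (auto simp: bverts_def distinct_map inj_on_def set_index_pairs nth_eq_iff_index_eq)
  have "set vs = (!) vs ` {..<n}"
    by (auto simp: in_set_conv_nth)
  then have "set vs \<times> {..<m} = map_prod ((!) vs) id ` ({..<n} \<times> {..<m})"
    by (simp add: map_prod_surj_on)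
  then show "set bverts = (\<lambda>(v, p). BaseVert v p) ` (set vs \<times> {..<m})"
    by (simp add: bverts_def set_index_pairs image_image split_def)
qed

definition cyl_inner :: "nat \<times> ('v \<times> 'v) \<Rightarrow> ('v, 'h) construct_vertex list" where
  "cyl_inner k = map (InnerVert (fst k) (snd k)) (inner (fst k))"

text \<open>The inverse kernel of a block has to be a function of construct vertices, whereas
  \<open>res_entry\<close> takes cylinder vertices. Blocks consist of inner vertices, so the
  unspecified value is never read.\<close>

definition inner_label :: "('v, 'h) construct_vertex \<Rightarrow> 'h" where
  "inner_label x = (case x of InnerVert i e c \<Rightarrow> c | BaseVert v p \<Rightarrow> undefined)"

lemma fmat_cyl_inner:
  assumes "i < t" "e \<in> ors i"
  shows "fmat (char_entry K) (cyl_inner (i, e)) (cyl_inner (i, e)) =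
    fmat (char_entry (H i)) (inner i) (inner i)"
  unfolding cyl_inner_def fmat_map using assms by (auto intro!: fmat_cong simp: char_entry_inner_inner)

lemma char_poly_construct:
  assumes ws: "distinct ws" "set ws = pverts K"
  shows "to_fract (char_poly (adjacency_matrix K ws)) =
    (\<Prod>i<t. to_fract (char_poly (Cmat (Hs i))) ^ edge_count (Gs i)) *
    det (fmat (\<lambda>x y. char_entry K x y - (\<Sum>i<t. \<Sum>e\<in>ors i. \<Sum>c\<in>set (inner i). \<Sum>d\<in>set (inner i).
      char_entry K x (InnerVert i e c) * res_entry (Hs i) c d * char_entry K (InnerVert i e d) y))
      bverts bverts)"
proof -
  let ?f = "char_entry K" and ?S = "Sigma {..<t} ors"
  let ?g = "\<lambda>k x y. res_entry (Hs (fst k)) (inner_label x) (inner_label y)"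
  have fin: "finite (ors i)" if "i < t" for i
    using ors[OF that] pair_graph_finite[OF Gs(1)[OF that]] finite_subset
    by (auto simp: orientation_def)
  then have "finite ?S" by auto
  then obtain ks where ks: "set ks = ?S" "distinct ks"
    using finite_distinct_list by blast
  \<comment> \<open>Base vertices first, then one block for each copy, in any order of the copies.
    The given list \<open>ws\<close> is brought into this order by
    \<open>det_fmat_reorder\<close>.\<close>
  let ?ws = "bverts @ concat (map cyl_inner ks)"
  have di: "distinct (cyl_inner k)" if "k \<in> ?S" for k
    using that cyl_verts(3)[of "fst k"] by (auto simp: cyl_inner_def distinct_map inj_on_def)
  have "distinct (concat (map cyl_inner ks))"
    using ks di by (intro distinct_concat_map) (auto simp: cyl_inner_def)
  then have d: "distinct ?ws"
    using bverts(1) ks by (auto simp: bverts(2) cyl_inner_def)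
  have s: "set ?ws = pverts K"
    using ks by (auto simp: construct_verts bverts(2) cyl_inner_def)
  have inv: "fmat ?f (cyl_inner k) (cyl_inner k) * fmat (?g k) (cyl_inner k) (cyl_inner k) =
      1\<^sub>m (length (cyl_inner k))" if k: "k \<in> set ks" for k
  proof -
    obtain i e where ie: "k = (i, e)" "i < t" "e \<in> ors i"
      using k ks by auto
    have "fmat (?g k) (cyl_inner k) (cyl_inner k) = fmat (res_entry (Hs i)) (inner i) (inner i)"
      by (simp add: ie(1) cyl_inner_def fmat_map inner_label_def)
    then show ?thesis
      using fmat_cyl_inner[OF ie(2,3)] resolvent(2)[OF cyl_verts(3)[OF ie(2)]]
      by (simp add: ie(1) cyl_inner_def)
  qed
  have z: "?f c d = 0" if "k \<in> set ks" "k' \<in> set ks" "k \<noteq> k'" "c \<in> set (cyl_inner k)"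
    "d \<in> set (cyl_inner k')" for k k' c d
    using that arc_inner_inner'[of "fst k" "snd k" _ "fst k'" "snd k'"]
    by (auto simp: char_entry_def ind_def cyl_inner_def prod_eq_iff)
  have "to_fract (char_poly (adjacency_matrix K ws)) = det (fmat ?f ?ws ?ws)"
    using char_poly_adjacency[OF ws(1)] det_fmat_reorder[OF ws(1) d] ws(2) s by simp
  also have "\<dots> = (\<Prod>k\<in>?S. det (fmat ?f (cyl_inner k) (cyl_inner k))) *
      det (fmat (\<lambda>x y. ?f x y - (\<Sum>k\<in>?S. \<Sum>c\<in>set (cyl_inner k). \<Sum>d\<in>set (cyl_inner k).
        ?f x c * ?g k c d * ?f d y)) bverts bverts)"
    using det_fmat_blocks[of ks cyl_inner ?f ?g bverts, OF ks(2) _ inv z] di ks(1) by simp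
  also have "(\<Prod>k\<in>?S. det (fmat ?f (cyl_inner k) (cyl_inner k))) =
      (\<Prod>i<t. \<Prod>e\<in>ors i. to_fract (char_poly (Cmat (Hs i))))"
    using fin
    by (subst prod.Sigma)
      (auto intro!: prod.cong simp: fmat_cyl_inner char_poly_adjacency cyl_verts(3) Cmat_def)
  \<comment> \<open>An orientation has one arc for each edge, so its cardinality is the
    exponent.\<close>
  also have "\<dots> = (\<Prod>i<t. to_fract (char_poly (Cmat (Hs i))) ^ edge_count (Gs i))"
    using edge_count_orientation[OF Gs(1) ors] by simp
  also have "(\<lambda>x y. ?f x y - (\<Sum>k\<in>?S. \<Sum>c\<in>set (cyl_inner k). \<Sum>d\<in>set (cyl_inner k).
        ?f x c * ?g k c d * ?f d y)) =
      (\<lambda>x y. ?f x y - (\<Sum>i<t. \<Sum>e\<in>ors i. \<Sum>c\<in>set (inner i). \<Sum>d\<in>set (inner i).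
      ?f x (InnerVert i e c) * res_entry (Hs i) c d * ?f (InnerVert i e d) y))"
  proof (intro ext arg_cong2[where f = "(-)"] refl)
    fix x y
    have "(\<Sum>c\<in>set (cyl_inner k). \<Sum>d\<in>set (cyl_inner k). ?f x c * ?g k c d * ?f d y) =
        (\<Sum>c\<in>set (inner (fst k)). \<Sum>d\<in>set (inner (fst k)).
          ?f x (InnerVert (fst k) (snd k) c) * res_entry (Hs (fst k)) c d *
          ?f (InnerVert (fst k) (snd k) d) y)" for k
      unfolding cyl_inner_def set_map
      by (simp add: sum.reindex inj_on_def inner_label_def)
    then show "(\<Sum>k\<in>?S. \<Sum>c\<in>set (cyl_inner k). \<Sum>d\<in>set (cyl_inner k). ?f x c * ?g k c d * ?f d y) =
        (\<Sum>i<t. \<Sum>e\<in>ors i. \<Sum>c\<in>set (inner i). \<Sum>d\<in>set (inner i).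
          ?f x (InnerVert i e c) * res_entry (Hs i) c d * ?f (InnerVert i e d) y)"
      using fin by (subst sum.Sigma) (auto simp: split_def)
  qed
  finally show ?thesis .
qed

text \<open>Summation over the oriented edges has turned the single contributions into adjacency and
  degree entries, so the two sides can be compared position by position.\<close>

lemma reduced_matrix:
  "fmat (\<lambda>x y. char_entry K x y - (\<Sum>i<t. \<Sum>e\<in>ors i. \<Sum>c\<in>set (inner i). \<Sum>d\<in>set (inner i).
      char_entry K x (InnerVert i e c) * res_entry (Hs i) c d * char_entry K (InnerVert i e d) y))
      bverts bverts =
    kronecker (1\<^sub>m n) (ratvar \<cdot>\<^sub>m 1\<^sub>m m - lift_mat (base_matrix B)) -
      sum_mats (n * m) (n * m)
        (\<lambda>i. kronecker (lift_mat (adjacency_matrix (Gs i) vs)) (lift_mat (Ebb' (Hs i)) + Ra (Hs i)) +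
             kronecker (lift_mat (degree_matrix (Gs i) vs)) (Rd (Hs i))) {..<t}"
  (is "?L = kronecker _ ?X - sum_mats _ _ ?M _")
proof (rule eq_matI)
  fix p q assume "p < dim_row (kronecker (1\<^sub>m n) ?X - sum_mats (n * m) (n * m) ?M {..<t})"
    "q < dim_col (kronecker (1\<^sub>m n) ?X - sum_mats (n * m) (n * m) ?M {..<t})"
  then have pq: "p < n * m" "q < n * m" by (simp_all add: sum_mats_def)
  \<comment> \<open>In Kronecker order the quotient is the index of a vertex of G and the remainder
    is a base label.\<close>
  define j k r s where jk: "j = p div m" "k = q div m" "r = p mod m" "s = q mod m"
  have l: "j < n" "k < n" "r < m" "s < m"
    using pq m(2) by (simp_all add: jk less_mult_imp_div_less)
  let ?u = "vs ! j" and ?v = "vs ! k"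
  have uv: "?u \<in> set vs" "?u = ?v \<longleftrightarrow> j = k"
    using l vs by (simp_all add: nth_eq_iff_index_eq)
  have X: "?X = fmat (char_entry B) [0..<m] [0..<m]"
    using char_matrix_adjacency[of "[0..<m]" B] by (simp add: base_matrix_def m(1))
  have Xc: "?X \<in> carrier_mat m m"
    unfolding X by (rule carrier_matI) simp_all
  have lhs: "?L $$ (p, q) = char_entry K (BaseVert ?u r) (BaseVert ?v s) -
      (\<Sum>i<t. ind (Gs i) ?u ?v * res_form (Hs i) (b i ! r) (b' i ! s) +
        (if ?u = ?v then of_nat (out_degree (with_proj (Gs i)) ?u) else 0) *
          res_form (Hs i) (b i ! r) (b i ! s))"
    using pq l by (simp add: bverts(3) bverts_def jk[symmetric] cylinder_contributions)
  have "kronecker (1\<^sub>m n) ?X $$ (p, q) = (if j = k then 1 else 0) * char_entry B r s"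
    using l unfolding kronecker_index[OF one_carrier_mat Xc pq] by (simp add: X jk[symmetric])
  moreover have "?M i $$ (p, q) = ind (Gs i) ?u ?v *
        (ind (H i) (b i ! r) (b' i ! s) + res_form (Hs i) (b i ! r) (b' i ! s)) +
      (if j = k then of_nat (out_degree (with_proj (Gs i)) ?u) else 0) *
        res_form (Hs i) (b i ! r) (b i ! s)" if "i < t" for i
  proof -
    note len = lengths[OF that] and R = Rd_Ra_eq[OF cyl_verts(3)[OF that]]
    have E: "lift_mat (Ebb' (Hs i)) = fmat (ind (H i)) (b i) (b' i)"
      by (simp add: Ebb'_def lift_adjacency_block)
    have D: "lift_mat (degree_matrix (Gs i) vs) \<in> carrier_mat n n"
      "lift_mat (degree_matrix (Gs i) vs) $$ (j, k) =
        (if j = k then of_nat (out_degree (with_proj (Gs i)) ?u) else 0)"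
      using l by (auto simp: lift_mat_def degree_matrix_def ratconst_of_nat)
    have c: "fmat (ind (H i)) (b i) (b' i) + fmat (res_form (Hs i)) (b i) (b' i) \<in> carrier_mat m m"
      "fmat (res_form (Hs i)) (b i) (b i) \<in> carrier_mat m m"
      using len dim_fmat(3) by (metis add_carrier_mat)+
    have 1: "kronecker (lift_mat (adjacency_matrix (Gs i) vs)) (lift_mat (Ebb' (Hs i)) + Ra (Hs i)) $$ (p, q) =
      ind (Gs i) ?u ?v * (ind (H i) (b i ! r) (b' i ! s) + res_form (Hs i) (b i ! r) (b' i ! s))"
      unfolding E R adjacency_matrix_def lift_adjacency_block
      using pq l len by (subst kronecker_index[OF dim_fmat(3) c(1)]) (simp_all add: jk[symmetric])
    have 2: "kronecker (lift_mat (degree_matrix (Gs i) vs)) (Rd (Hs i)) $$ (p, q) =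
      (if j = k then of_nat (out_degree (with_proj (Gs i)) ?u) else 0) *
        res_form (Hs i) (b i ! r) (b i ! s)"
      unfolding R
      using pq l len D(2) by (subst kronecker_index[OF D(1) c(2)]) (simp_all add: jk[symmetric])
    have "dim_row (kronecker (lift_mat (degree_matrix (Gs i) vs)) (Rd (Hs i))) = n * m"
      "dim_col (kronecker (lift_mat (degree_matrix (Gs i) vs)) (Rd (Hs i))) = n * m"
      using D(1) len by (auto simp: kronecker_def R)
    then show ?thesis using 1 2 pq by simp
  qed
  ultimately have "(kronecker (1\<^sub>m n) ?X - sum_mats (n * m) (n * m) ?M {..<t}) $$ (p, q) =
    (if j = k then 1 else 0) * char_entry B r s - (\<Sum>i<t. ind (Gs i) ?u ?v *
        (ind (H i) (b i ! r) (b' i ! s) + res_form (Hs i) (b i ! r) (b' i ! s)) +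
      (if j = k then of_nat (out_degree (with_proj (Gs i)) ?u) else 0) *
        res_form (Hs i) (b i ! r) (b i ! s))"
    using pq by (simp add: sum_mats_def)
  then show "?L $$ (p, q) = (kronecker (1\<^sub>m n) ?X - sum_mats (n * m) (n * m) ?M {..<t}) $$ (p, q)"
    unfolding lhs char_entry_base_base[OF uv(1) l(3,4)] uv(2)
    by (simp add: sum.distrib distrib_left)
qed (simp_all add: bverts(3) sum_mats_def)

section \<open>Simultaneous diagonalisation and cylinders without inner vertices\<close>

lemma Ebb'_carrier: "i < t \<Longrightarrow> Ebb' (Hs i) \<in> carrier_mat m m"
  using lengths[of i] by (auto simp: Ebb'_def adjacency_block_def)

lemma Rd_Ra_carrier: "i < t \<Longrightarrow> Rd (Hs i) \<in> carrier_mat m m" "i < t \<Longrightarrow> Ra (Hs i) \<in> carrier_mat m m"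
  using lengths[of i] Rd_Ra_eq[OF cyl_verts(3), of i] by (auto intro!: carrier_matI)

lemma base_matrix_carrier: "base_matrix B \<in> carrier_mat m m"
  by (auto simp: base_matrix_def adjacency_matrix_def adjacency_block_def m(1))

text \<open>The condition \<open>deg\<close> is put on products with entries of \<open>Rd\<close>.
  It is met with \<open>\<delta> i\<close> the common degree when the graphs are regular, and with
  \<open>\<delta> i = 0\<close> when \<open>Rd\<close> vanishes.\<close>

lemma det_diagonalised:
  assumes "compatible_numbering vs t Gs \<theta>"
    and deg: "\<And>i j p q. i < t \<Longrightarrow> j < n \<Longrightarrow> p < m \<Longrightarrow> q < m \<Longrightarrow>
      of_nat (out_degree (with_proj (Gs i)) (vs ! j)) * Rd (Hs i) $$ (p, q) = \<delta> i * Rd (Hs i) $$ (p, q)"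
  shows "det (kronecker (1\<^sub>m n) (ratvar \<cdot>\<^sub>m 1\<^sub>m m - lift_mat (base_matrix B)) -
      sum_mats (n * m) (n * m)
        (\<lambda>i. kronecker (lift_mat (adjacency_matrix (Gs i) vs)) (lift_mat (Ebb' (Hs i)) + Ra (Hs i)) +
             kronecker (lift_mat (degree_matrix (Gs i) vs)) (Rd (Hs i))) {..<t}) =
    (\<Prod>j<n. rat_phi (lift_mat (base_matrix B) + sum_mats m m
      (\<lambda>i. \<delta> i \<cdot>\<^sub>m Rd (Hs i) + ratconst (\<theta> i j) \<cdot>\<^sub>m (lift_mat (Ebb' (Hs i)) + Ra (Hs i))) {..<t}))"
proof -
  let ?X = "ratvar \<cdot>\<^sub>m 1\<^sub>m m - lift_mat (base_matrix B)"
  let ?A = "\<lambda>i. adjacency_matrix (Gs i) vs"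
  obtain U where U: "U \<in> carrier_mat n n" "U * mat_adjoint U = 1\<^sub>m n"
    and diag: "\<And>i. i < t \<Longrightarrow> diagonal_mat (U * ?A i * minverse U)"
      "\<And>i j. i < t \<Longrightarrow> j < n \<Longrightarrow> (U * ?A i * minverse U) $$ (j, j) = \<theta> i j"
    using assms(1) unfolding compatible_numbering_def by blast
  have "mat_adjoint U \<in> carrier_mat n n"
    using U(1) by (simp add: mat_adjoint_def mat_of_rows_def)
  \<comment> \<open>Unitarity makes the determinant nonzero, so \<open>minverse U\<close> is a
    genuine inverse rather than the unspecified value of \<open>the None\<close>.\<close>
  then have "det U * det (mat_adjoint U) = 1"
    using U by (metis det_mult det_one)
  then have "det U \<noteq> 0" by auto
  note V = minverse[OF U(1) this]
  have A: "?A i \<in> carrier_mat n n" for i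
    by (simp add: adjacency_matrix_def adjacency_block_def)
  have lc: "lift_mat M \<in> carrier_mat a c" if "M \<in> carrier_mat a c" for M a c
    using that by (simp add: lift_mat_def)
  have B: "lift_mat (base_matrix B) \<in> carrier_mat m m"
    by (rule lc[OF base_matrix_carrier])
  \<comment> \<open>The complex diagonalisation transfers to rational functions because
    \<open>lift_mat\<close> is multiplicative.\<close>
  have UAV: "(lift_mat U * lift_mat (?A i) * lift_mat (minverse U)) $$ (j, k) =
      (if j = k then ratconst (\<theta> i j) else 0)" if "i < t" "j < n" "k < n" for i j k
  proof -
    have "lift_mat U * lift_mat (?A i) * lift_mat (minverse U) = lift_mat (U * ?A i * minverse U)"
      by (simp only: lift_mat_mult[OF U(1) A] lift_mat_mult[OF mult_carrier_mat[OF U(1) A] V(1)])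
    moreover have "lift_mat W $$ (j, k) = (if j = k then ratconst (\<theta> i j) else 0)"
      if "W \<in> carrier_mat n n" "diagonal_mat W" "W $$ (j, j) = \<theta> i j" for W
      using that \<open>j < n\<close> \<open>k < n\<close> by (auto simp: lift_mat_def diagonal_mat_def)
    ultimately show ?thesis
      using diag(1)[OF that(1)] diag(2)[OF that(1,2)] mult_carrier_mat[OF mult_carrier_mat[OF U(1) A] V(1)]
      by simp
  qed
  have UV: "lift_mat U * lift_mat (minverse U) = 1\<^sub>m n"
    unfolding lift_mat_mult[OF U(1) V(1), symmetric] V(2)
    by (intro eq_matI) (auto simp: lift_mat_def)
  have D: "lift_mat (degree_matrix (Gs i) vs) \<in> carrier_mat n n" for i
    by (rule lc) (simp add: degree_matrix_def)
  have DR: "lift_mat (degree_matrix (Gs i) vs) $$ (j, k) * Rd (Hs i) $$ (p, q) =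
      (if j = k then \<delta> i * Rd (Hs i) $$ (p, q) else 0)"
    if "i < t" "j < n" "k < n" "p < m" "q < m" for i j k p q
    using that deg[OF that(1,2,4,5)]
    by (cases "j = k") (simp_all add: lift_mat_def degree_matrix_def ratconst_of_nat)
  have "det (kronecker (1\<^sub>m n) ?X - sum_mats (n * m) (n * m)
        (\<lambda>i. kronecker (lift_mat (?A i)) (lift_mat (Ebb' (Hs i)) + Ra (Hs i)) +
             kronecker (lift_mat (degree_matrix (Gs i) vs)) (Rd (Hs i))) {..<t}) =
    (\<Prod>j<n. det (?X - sum_mats m m
      (\<lambda>i. \<delta> i \<cdot>\<^sub>m Rd (Hs i) + ratconst (\<theta> i j) \<cdot>\<^sub>m (lift_mat (Ebb' (Hs i)) + Ra (Hs i))) {..<t}))"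
    by (rule det_kronecker_diagonal[where U = "lift_mat U" and V = "lift_mat (minverse U)"])
      (use B A D Rd_Ra_carrier Ebb'_carrier lc U(1) V(1) UV UAV DR in \<open>auto intro!: minus_carrier_mat\<close>)
  also have "\<dots> = (\<Prod>j<n. rat_phi (lift_mat (base_matrix B) + sum_mats m m
      (\<lambda>i. \<delta> i \<cdot>\<^sub>m Rd (Hs i) + ratconst (\<theta> i j) \<cdot>\<^sub>m (lift_mat (Ebb' (Hs i)) + Ra (Hs i))) {..<t}))"
  proof (rule prod.cong[OF refl])
    fix j
    have "?X - S = ratvar \<cdot>\<^sub>m 1\<^sub>m m - (lift_mat (base_matrix B) + S)" if "S \<in> carrier_mat m m" for S
      using B that by (intro eq_matI) auto
    then show "det (?X - sum_mats m m
      (\<lambda>i. \<delta> i \<cdot>\<^sub>m Rd (Hs i) + ratconst (\<theta> i j) \<cdot>\<^sub>m (lift_mat (Ebb' (Hs i)) + Ra (Hs i))) {..<t}) =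
      rat_phi (lift_mat (base_matrix B) + sum_mats m m
      (\<lambda>i. \<delta> i \<cdot>\<^sub>m Rd (Hs i) + ratconst (\<theta> i j) \<cdot>\<^sub>m (lift_mat (Ebb' (Hs i)) + Ra (Hs i))) {..<t})"
      by (simp add: rat_phi_def sum_mats_def)
  qed
  finally show ?thesis .
qed

lemma Rd_Ra_no_inner:
  assumes "i < t" "inner i = []"
  shows "Rd (Hs i) = 0\<^sub>m m m" "Ra (Hs i) = 0\<^sub>m m m"
  using lengths[OF assms(1)] assms(2) unfolding Rd_Ra_eq[OF cyl_verts(3)[OF assms(1)]]
  by (auto intro!: eq_matI simp: res_form_def)

lemma char_poly_no_inner:
  assumes "inner i = []"
  shows "char_poly (Cmat (Hs i)) = 1"
  using assms by (simp add: char_poly_def Cmat_def adjacency_matrix_def adjacency_block_def)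

text \<open>With R_d = R_a = 0 the matrix is the lift of a complex one, so \<open>rat_phi\<close> is
  an ordinary characteristic polynomial. The coefficient 0 matches the choice of \<delta> used for
  (b).\<close>

lemma rat_phi_no_inner:
  assumes "\<forall>i<t. inner i = []"
  shows "rat_phi (lift_mat (base_matrix B) + sum_mats m m
      (\<lambda>i. 0 \<cdot>\<^sub>m Rd (Hs i) + ratconst (\<theta> i) \<cdot>\<^sub>m (lift_mat (Ebb' (Hs i)) + Ra (Hs i))) {..<t}) =
    to_fract (char_poly (base_matrix B + sum_mats m m (\<lambda>i. \<theta> i \<cdot>\<^sub>m Ebb' (Hs i)) {..<t}))"
proof -
  interpret comm_ring_hom ratconst by (rule ratconst_hom)
  let ?M = "base_matrix B + sum_mats m m (\<lambda>i. \<theta> i \<cdot>\<^sub>m Ebb' (Hs i)) {..<t}"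
  have "lift_mat (base_matrix B) + sum_mats m m
      (\<lambda>i. 0 \<cdot>\<^sub>m Rd (Hs i) + ratconst (\<theta> i) \<cdot>\<^sub>m (lift_mat (Ebb' (Hs i)) + Ra (Hs i))) {..<t} = lift_mat ?M"
  proof (rule eq_matI)
    fix p q assume "p < dim_row (lift_mat ?M)" "q < dim_col (lift_mat ?M)"
    then have pq: "p < m" "q < m" by (simp_all add: lift_mat_def sum_mats_def)
    have "(0 \<cdot>\<^sub>m Rd (Hs i) + ratconst (\<theta> i) \<cdot>\<^sub>m (lift_mat (Ebb' (Hs i)) + Ra (Hs i))) $$ (p, q) =
        ratconst ((\<theta> i \<cdot>\<^sub>m Ebb' (Hs i)) $$ (p, q))" if "i < t" for i
      using pq Rd_Ra_no_inner[OF that] assms that Ebb'_carrier[OF that]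
      by (simp add: lift_mat_def hom_mult)
    then show "(lift_mat (base_matrix B) + sum_mats m m
      (\<lambda>i. 0 \<cdot>\<^sub>m Rd (Hs i) + ratconst (\<theta> i) \<cdot>\<^sub>m (lift_mat (Ebb' (Hs i)) + Ra (Hs i))) {..<t}) $$ (p, q) =
      lift_mat ?M $$ (p, q)"
      using pq base_matrix_carrier by (simp add: lift_mat_def sum_mats_def hom_add hom_sum)
  qed (simp_all add: lift_mat_def sum_mats_def)
  moreover have "?M \<in> carrier_mat m m"
    by (simp add: sum_mats_def)
  ultimately show ?thesis using rat_phi_lift_mat by metis
qed

end

theorem theorem1:
  fixes t l n :: nat
    and G :: "'v pair_pre_digraph" and Gs :: "nat \<Rightarrow> 'v pair_pre_digraph"
    and vs :: "'v list" and \<theta> :: "nat \<Rightarrow> nat \<Rightarrow> complex"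
    and B :: "nat pair_pre_digraph" and Hs :: "nat \<Rightarrow> 'h cylinder"
    and ors :: "nat \<Rightarrow> ('v \<times> 'v) set" and ws :: "('v, 'h) construct_vertex list"
  assumes "t \<ge> 1"
    and "pair_graph G"
    and "distinct vs" "set vs = pverts G" "length vs = n"
    and "commutative_decomposition vs t G Gs"
    and "compatible_numbering vs t Gs \<theta>"
    and "coherent B t Hs" "card (pverts B) = Suc l"
    and "\<forall>i<t. orientation (Gs i) (ors i)"
    and "distinct ws" "set ws = pverts (cylindrical_construct t ors Hs)"
  shows
    "to_fract (char_poly (adjacency_matrix (cylindrical_construct t ors Hs) ws)) =
       (\<Prod>i<t. to_fract (char_poly (Cmat (Hs i))) ^ edge_count (Gs i)) *
       det (kronecker (1\<^sub>m n) (ratvar \<cdot>\<^sub>m 1\<^sub>m (Suc l) - lift_mat (base_matrix B)) -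
            sum_mats (n * Suc l) (n * Suc l)
              (\<lambda>i. kronecker (lift_mat (adjacency_matrix (Gs i) vs)) (lift_mat (Ebb' (Hs i)) + Ra (Hs i)) +
                   kronecker (lift_mat (degree_matrix (Gs i) vs)) (Rd (Hs i)))
              {..<t})
     \<and> (\<forall>d :: nat \<Rightarrow> nat. (\<forall>i<t. regular_graph (d i) (Gs i)) \<longrightarrow>
          to_fract (char_poly (adjacency_matrix (cylindrical_construct t ors Hs) ws)) =
            (\<Prod>i<t. to_fract (char_poly (Cmat (Hs i))) ^ edge_count (Gs i)) *
            (\<Prod>j<n. rat_phi
               (lift_mat (base_matrix B) +
                sum_mats (Suc l) (Suc l)
                  (\<lambda>i. of_nat (d i) \<cdot>\<^sub>m Rd (Hs i) +
                       ratconst (\<theta> i j) \<cdot>\<^sub>m (lift_mat (Ebb' (Hs i)) + Ra (Hs i)))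
                  {..<t})))
     \<and> ((\<forall>i<t. inner_verts (Hs i) = []) \<longrightarrow>
          char_poly (adjacency_matrix (cylindrical_construct t ors Hs) ws) =
            (\<Prod>j<n. char_poly
               (base_matrix B +
                sum_mats (Suc l) (Suc l) (\<lambda>i. \<theta> i j \<cdot>\<^sub>m Ebb' (Hs i)) {..<t}))
          \<and> (parcs B = {} \<longrightarrow>
               char_poly (adjacency_matrix (cylindrical_construct t ors Hs) ws) =
                 (\<Prod>j<n. char_poly
                    (sum_mats (Suc l) (Suc l) (\<lambda>i. \<theta> i j \<cdot>\<^sub>m Ebb' (Hs i)) {..<t}))))"
    (is "?main \<and> (\<forall>d. ?reg d \<longrightarrow> ?a d) \<and> (?no_inner \<longrightarrow> ?b \<and> (parcs B = {} \<longrightarrow> ?c))")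
proof -
  have dec: "pair_graph (Gs i)" "pverts (Gs i) = set vs" "\<And>v. v \<in> set vs \<Longrightarrow> \<exists>w. (v, w) \<in> parcs (Gs i)"
    if "i < t" for i
    using assms(4,6) that by (auto simp: commutative_decomposition_def spanning_def)
  interpret cylinder_system t "Suc l" vs Gs B Hs ors
    by (rule cylinder_system.intro)
      (use assms dec in \<open>auto simp: commutative_decomposition_def coherent_def\<close>)
  have main: ?main
    using char_poly_construct[OF assms(11,12)] unfolding reduced_matrix assms(5) .
  have a: "?a d" if reg: "?reg d" for d
  proof -
    have "out_degree (with_proj (Gs i)) (vs ! j) = d i" if "i < t" "j < n" for i j
      using reg that dec(2)[OF that(1)] assms(5) by (auto simp: regular_graph_def)
    then show ?thesis
      unfolding main
      using det_diagonalised[OF assms(7), of "\<lambda>i. of_nat (d i)"] by (simp add: assms(5))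
  qed
  have b: ?b if ni: ?no_inner
  proof -
    \<comment> \<open>Degrees may vary from vertex to vertex here: \<open>Rd\<close> is the zero
      matrix, so \<delta> = 0 satisfies the degree condition.\<close>
    have "of_nat (out_degree (with_proj (Gs i)) (vs ! j)) * Rd (Hs i) $$ (p, q) = 0 * Rd (Hs i) $$ (p, q)"
      if "i < t" "p < Suc l" "q < Suc l" for i j p q
      using that ni Rd_Ra_no_inner(1)[OF that(1)] by simp
    from det_diagonalised[OF assms(7), of "\<lambda>_. 0", OF this]
    have "to_fract (char_poly (adjacency_matrix K ws)) =
      (\<Prod>j<n. to_fract (char_poly
        (base_matrix B + sum_mats (Suc l) (Suc l) (\<lambda>i. \<theta> i j \<cdot>\<^sub>m Ebb' (Hs i)) {..<t})))"
      using ni by (simp add: main assms(5) rat_phi_no_inner[OF ni] char_poly_no_inner)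
    also have "\<dots> = to_fract (\<Prod>j<n. char_poly
        (base_matrix B + sum_mats (Suc l) (Suc l) (\<lambda>i. \<theta> i j \<cdot>\<^sub>m Ebb' (Hs i)) {..<t}))"
      by (induction n) (simp_all add: to_fract_mult)
    \<comment> \<open>Part (b) is an identity of polynomials; injectivity of \<open>to_fract\<close>
      recovers it from the one between rational functions.\<close>
    finally show ?thesis by (simp only: to_fract_eq_iff)
  qed
  have c: ?c if ni: ?no_inner and "parcs B = {}"
  proof -
    have "base_matrix B = 0\<^sub>m (Suc l) (Suc l)"
      using that(2) m(1) by (intro eq_matI) (auto simp: base_matrix_def adjacency_matrix_def adjacency_block_def)
    then show ?thesis
      using b[OF ni] by (simp add: sum_mats_def)
  qed
  show ?thesis using main a b c by blast
qed

end
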